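(* Let $d\in\mathbb{N}$ and let $\mathcal{T}$ be an (unparametrized) tree of level $d$. Then its Poincaré series $P_{\mathcal{T}}(Z):=\sum_{\lambda=0}^\infty\#\{v\in\mathcal{T}\mid\mathrm{depth}(v)=\lambda\}\cdot Z^\lambda\in\mathbb{Z}[[Z]]$ is a rational function, i.e. $P_{\mathcal{T}}(Z)\in\mathbb{Q}(Z)$.
   Context: Fix a prime $p$. $\Gamma=\mathbb{Z}$; $\mathbb{N}=\{0,1,2,\dots\}$. A subset of $\Gamma^m$ is called definable if it is first-order definable in $(\Gamma,0,+,<)$ with parameters. For $M\subset\Gamma^m$, a function $\ell\colon M\to\Gamma\cup\{\infty\}$ is linear if it is constant $\infty$, or takes values in $\Gamma$ and is of the form $\kappa\mapsto a_1\kappa_1+\dots+a_m\kappa_m+b$ with $a_i,b\in\mathbb{Q}$. Trees: a tree is a rooted tree (a set of nodes with an is-child-of relation), possibly infinite, possibly empty; a leaf is a node without children; $\mathrm{depth}(v)$ is the distance of $v$ from the root; an edge is a pair (node, child). The product $\mathcal{T}_1\times\mathcal{T}_2$ is layerwise: its nodes of depth $\lambda$ are pairs of nodes of depth $\lambda$, with componentwise child relation. Attaching a non-empty tree $\mathcal{T}'$ to a node $v$ of $\mathcal{T}$ means taking the disjoint union and identifying the root of $\mathcal{T}'$ with $v$. $\mathrm{T}(\mathbb{Z}_p)$ denotes the infinite tree in which each node has exactly $p$ children. (A level $d$ tree, as defined below, has only finitely many nodes at each depth.) Trees of level $d$. A parametrized tree is a map $\mathcal{T}\colon M\to\{\text{trees}\}$,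 $M\subset\Gamma^m$ definable. It is of level $d$ if it is (pointwise in $\kappa\in M$) isomorphic to one constructed from a level $d$ datum on $M$, as follows. Level $0$ datum on $M$: a finite, possibly empty, tree $\mathcal{S}$ (its nodes are called joints, its edges bones) and for each bone $e=(w,w')$ a linear function $\ell_e\colon M\to\Gamma_{>0}\cup\{\infty\}$ (the length), where $\infty$ is allowed only if $w'$ is a leaf of $\mathcal{S}$. A joint at the lower end of a bone of length $\infty$ is virtual, all others are real. The tree $\mathcal{T}(\kappa)$: take a copy of $\mathcal{S}$ without virtual joints, writing $w(\kappa)$ for the copy of $w$; for each bone $e=(w,w')$ insert $\ell_e(\kappa)-1$ nodes between $w(\kappa)$ and $w'(\kappa)$ (so as to get a path of length $\ell_e(\kappa)$) if $w'$ is real, and add an infinite path below $w(\kappa)$ if $w'$ is virtual; $e(\kappa)$ denotes the set of these new nodes. The depth of a joint $w$ is the function $\mathrm{depth}(w)\colon\kappa\mapsto\mathrm{depth}(w(\kappa))$ if $w$ is real, and constant $\infty$ if $w$ is virtual. Side branch datum of level $d$ on $M$: a non-empty finite tree $\mathcal{F}$ and for each leaf $w$ of $\mathcal{F}$ a level $d$ tree $\mathcal{T}_w\colon M\to\{\text{trees}\}$ with all $\mathcal{T}_w(\kappa)$ non-empty. The side branch $\mathcal{B}(\kappa)$ is $\mathcal{F}$ with $\mathrm{T}(\mathbb{Z}_p)\times\mathcal{T}_w(\kappa)$ attached to each leaf $w$. Level $d+1$ datum on $M$: an element $\rho\in\Gamma_{>0}$; a level $0$ datum $(\mathcal{S},(\ell_e))$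 on $M$ such that for each bone $e$, $\ell_e(\kappa)\bmod\rho$ does not depend on $\kappa$, with corresponding tree $\mathcal{T}_0$ (the skeleton); for each real joint $w$ a side branch $\mathcal{B}_w$ of level $d$ on $M$ (given by a datum); for each bone $e=(w,w')$ and each class $\Xi\in\Gamma/\rho\Gamma$ a side branch $\mathcal{B}_{e,\Xi}$ of level $d$ on $N_{e,\Xi}=\{(\kappa,\lambda)\in M\times\Xi\mid\mathrm{depth}(w)(\kappa)<\lambda<\mathrm{depth}(w')(\kappa)\}$. The tree $\mathcal{T}(\kappa)$ is $\mathcal{T}_0(\kappa)$ with $\mathcal{B}_w(\kappa)$ attached to $w(\kappa)$ for each real joint $w$, and $\mathcal{B}_{e,\Xi}(\kappa,\mathrm{depth}(v))$ attached to each $v\in e(\kappa)$ with $\mathrm{depth}(v)\in\Xi$. An unparametrized tree of level $d$ is the case where $M=\Gamma^0$ is a one-point set. *)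

theory Defs
  imports
    "HOL-Computational_Algebra.Computational_Algebra"
    "HOL-Number_Theory.Cong"
    "HOL-Library.Extended"
begin

section \<open>Definable sets and linear functions\<close>

text \<open>
  \<open>\<Gamma>\<close> is \<^typ>\<open>int\<close>; a point of \<open>\<Gamma>\<^sup>m\<close> is an \<^typ>\<open>int list\<close> of length \<open>m\<close>, so that
  \<open>\<Gamma>\<^sup>0\<close> is \<^term>\<open>{[]}\<close>. Formulas use named variables; the coordinates of a point of \<open>\<Gamma>\<^sup>m\<close>
  are the values of the variables \<open>0, \<dots>, m - 1\<close>, and all further free variables get the value
  \<open>0\<close>, which adds nothing since parameters are allowed.
\<close>

datatype pterm = Var nat | Param int | Zero | Plus pterm pterm

datatype pform = Eq pterm pterm | Less pterm pterm | Neg pform | Conj pform pform | Exi nat pform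

primrec eval_pterm :: "(nat \<Rightarrow> int) \<Rightarrow> pterm \<Rightarrow> int" where
  "eval_pterm s (Var i) = s i"
| "eval_pterm s (Param c) = c"
| "eval_pterm s Zero = 0"
| "eval_pterm s (Plus t u) = eval_pterm s t + eval_pterm s u"

primrec sat :: "(nat \<Rightarrow> int) \<Rightarrow> pform \<Rightarrow> bool" where
  "sat s (Eq t u) \<longleftrightarrow> eval_pterm s t = eval_pterm s u"
| "sat s (Less t u) \<longleftrightarrow> eval_pterm s t < eval_pterm s u"
| "sat s (Neg f) \<longleftrightarrow> \<not> sat s f"
| "sat s (Conj f g) \<longleftrightarrow> sat s f \<and> sat s g"
| "sat s (Exi i f) \<longleftrightarrow> (\<exists>x. sat (s(i := x)) f)"

definition definable :: "nat \<Rightarrow> int list set \<Rightarrow> bool" where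
  "definable m M \<longleftrightarrow>
    (\<exists>f. M = {\<kappa>. length \<kappa> = m \<and> sat (\<lambda>i. if i < m then \<kappa> ! i else 0) f})"

text \<open>
  The value \<open>\<infinity>\<close> is \<^const>\<open>Pinf\<close>; the value \<^const>\<open>Minf\<close> of \<^typ>\<open>int extended\<close> is
  excluded by linearity.
\<close>

definition linear_on :: "nat \<Rightarrow> int list set \<Rightarrow> (int list \<Rightarrow> int extended) \<Rightarrow> bool" where
  "linear_on m M l \<longleftrightarrow>
    (\<forall>\<kappa>\<in>M. l \<kappa> = Pinf) \<or>
    (\<exists>(a :: nat \<Rightarrow> rat) (b :: rat). \<forall>\<kappa>\<in>M. \<exists>z. l \<kappa> = Fin z \<and>
        of_int z = (\<Sum>i<m. a i * of_int (\<kappa> ! i)) + b)"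


section \<open>Trees\<close>

text \<open>An edge \<open>(v, w)\<close> says that \<open>w\<close> is a child of \<open>v\<close>.\<close>

datatype 'a rtree = RTree (nodes: "'a set") (edges: "('a \<times> 'a) set")

definition rooted_tree :: "'a rtree \<Rightarrow> bool" where
  "rooted_tree T \<longleftrightarrow>
    edges T \<subseteq> nodes T \<times> nodes T \<and>
    (nodes T = {} \<or>
     (\<exists>r\<in>nodes T. (\<forall>u. (u, r) \<notin> edges T) \<and>
        (\<forall>v\<in>nodes T - {r}. \<exists>!u. (u, v) \<in> edges T) \<and>
        (\<forall>v\<in>nodes T. (r, v) \<in> (edges T)\<^sup>*)))"

definition root_of :: "'a rtree \<Rightarrow> 'a" where
  "root_of T = (THE r. r \<in> nodes T \<and> (\<forall>u. (u, r) \<notin> edges T))"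

definition depth :: "'a rtree \<Rightarrow> 'a \<Rightarrow> nat" where
  "depth T v = (LEAST n. (root_of T, v) \<in> edges T ^^ n)"

definition leaves :: "'a rtree \<Rightarrow> 'a set" where
  "leaves T = {v \<in> nodes T. \<forall>w. (v, w) \<notin> edges T}"

definition tree_iso :: "'a rtree \<Rightarrow> 'b rtree \<Rightarrow> bool" where
  "tree_iso T U \<longleftrightarrow>
    (\<exists>f. bij_betw f (nodes T) (nodes U) \<and>
         (\<forall>v\<in>nodes T. \<forall>w\<in>nodes T. (v, w) \<in> edges T \<longleftrightarrow> (f v, f w) \<in> edges U))"

definition tree_prod :: "'a rtree \<Rightarrow> 'b rtree \<Rightarrow> ('a \<times> 'b) rtree" where
  "tree_prod T U = RTree
    {(v, w). v \<in> nodes T \<and> w \<in> nodes U \<and> depth T v = depth U w}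
    {((v, w), (v', w')). (v, v') \<in> edges T \<and> (w, w') \<in> edges U \<and> depth T v = depth U w}"

text \<open>
  Simultaneously attach \<open>B v\<close> to \<open>v\<close>, for all \<open>v \<in> A\<close>: the root of \<open>B v\<close> is identified with \<open>v\<close>,
  any other node \<open>x\<close> of \<open>B v\<close> becomes \<open>Inr (v, x)\<close>.
\<close>

definition attach :: "'a rtree \<Rightarrow> 'a set \<Rightarrow> ('a \<Rightarrow> 'b rtree) \<Rightarrow> ('a + 'a \<times> 'b) rtree" where
  "attach T A B =
    (let emb = (\<lambda>v x. if x = root_of (B v) then Inl v else Inr (v, x)) in
     RTree
      (Inl ` nodes T \<union> {emb v x | v x. v \<in> A \<and> x \<in> nodes (B v)})
      ({(Inl v, Inl w) | v w. (v, w) \<in> edges T} \<union>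
       {(emb v x, emb v y) | v x y. v \<in> A \<and> (x, y) \<in> edges (B v)}))"

text \<open>\<open>T(\<int>\<^sub>p)\<close>, the tree in which each node has exactly \<open>p\<close> children.\<close>

definition Tzp :: "nat \<Rightarrow> nat list rtree" where
  "Tzp p = RTree {xs. set xs \<subseteq> {..<p}} {(xs, xs @ [a]) | xs a. set xs \<subseteq> {..<p} \<and> a < p}"


section \<open>Level 0 data\<close>

text \<open>
  A level 0 datum on \<open>M\<close> consists of a finite tree \<open>S\<close> and of a length \<open>l e\<close> for each bone
  (edge) \<open>e\<close> of \<open>S\<close>. Since lengths are linear, a bone has infinite length at one
  \<open>\<kappa> \<in> M\<close> iff it has infinite length at all of them. (If \<open>M\<close> is empty, no tree is constructed,
  and by convention no joint is virtual.)
\<close>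

type_synonym bone_lengths = "nat \<times> nat \<Rightarrow> int list \<Rightarrow> int extended"

definition infinite_bone :: "int list set \<Rightarrow> bone_lengths \<Rightarrow> nat \<times> nat \<Rightarrow> bool" where
  "infinite_bone M l e \<longleftrightarrow> (\<exists>\<kappa>\<in>M. l e \<kappa> = Pinf)"

definition level0_datum :: "nat \<Rightarrow> int list set \<Rightarrow> nat rtree \<Rightarrow> bone_lengths \<Rightarrow> bool" where
  "level0_datum m M S l \<longleftrightarrow>
    rooted_tree S \<and> finite (nodes S) \<and>
    (\<forall>e\<in>edges S. linear_on m M (l e) \<and> (\<forall>\<kappa>\<in>M. Fin 0 < l e \<kappa>) \<and>
       (infinite_bone M l e \<longrightarrow> snd e \<in> leaves S))"

definition virtual :: "int list set \<Rightarrow> nat rtree \<Rightarrow> bone_lengths \<Rightarrow> nat \<Rightarrow> bool" where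
  "virtual M S l w \<longleftrightarrow> (\<exists>e\<in>edges S. snd e = w \<and> infinite_bone M l e)"

definition real_joints :: "int list set \<Rightarrow> nat rtree \<Rightarrow> bone_lengths \<Rightarrow> nat set" where
  "real_joints M S l = {w \<in> nodes S. \<not> virtual M S l w}"

text \<open>
  In the tree of a level 0 datum, the node \<open>Inl w\<close> is the copy \<open>w(\<kappa>)\<close> of the real joint \<open>w\<close>, and
  \<open>Inr (e, i)\<close> is the \<open>i\<close>-th of the new nodes inserted on the bone \<open>e\<close>, counted from the upper
  end of \<open>e\<close> and starting with \<open>1\<close>. \<open>bone_node l e \<kappa> i\<close> is the node at distance \<open>i\<close> below the
  upper end of \<open>e\<close>, on the path replacing \<open>e\<close>.
\<close>

type_synonym skel_node = "nat + (nat \<times> nat) \<times> nat"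

definition bone_node :: "bone_lengths \<Rightarrow> nat \<times> nat \<Rightarrow> int list \<Rightarrow> nat \<Rightarrow> skel_node" where
  "bone_node l e \<kappa> i =
    (if i = 0 then Inl (fst e) else if l e \<kappa> = Fin (int i) then Inl (snd e) else Inr (e, i))"

definition skeleton ::
    "int list set \<Rightarrow> nat rtree \<Rightarrow> bone_lengths \<Rightarrow> int list \<Rightarrow> skel_node rtree" where
  "skeleton M S l \<kappa> = RTree
    (Inl ` real_joints M S l \<union>
     {Inr (e, i) | e i. e \<in> edges S \<and> 0 < i \<and> Fin (int i) < l e \<kappa>})
    {(bone_node l e \<kappa> i, bone_node l e \<kappa> (Suc i)) | e i. e \<in> edges S \<and> Fin (int i) < l e \<kappa>}"

definition joint_depth ::
    "int list set \<Rightarrow> nat rtree \<Rightarrow> bone_lengths \<Rightarrow> nat \<Rightarrow> int list \<Rightarrow> int extended" where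
  "joint_depth M S l w \<kappa> =
    (if virtual M S l w then Pinf else Fin (int (depth (skeleton M S l \<kappa>) (Inl w))))"


section \<open>Side branches\<close>

text \<open>
  A side branch datum is a finite tree \<open>F\<close> with a parametrized tree \<open>T w\<close> for each leaf \<open>w\<close> of \<open>F\<close>.
  The argument \<open>L\<close> says which parametrized trees on \<open>M\<close> have the required level.
\<close>

type_synonym side_data = "nat rtree \<times> (nat \<Rightarrow> int list \<Rightarrow> nat rtree)"

definition side_branch_datum ::
    "((int list \<Rightarrow> nat rtree) \<Rightarrow> bool) \<Rightarrow> int list set \<Rightarrow> side_data \<Rightarrow> bool" where
  "side_branch_datum L M B \<longleftrightarrow>
    (case B of (F, T) \<Rightarrow>
      rooted_tree F \<and> finite (nodes F) \<and> nodes F \<noteq> {} \<and>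
      (\<forall>w\<in>leaves F. L (T w) \<and> (\<forall>\<kappa>\<in>M. nodes (T w \<kappa>) \<noteq> {})))"

type_synonym side_node = "nat + nat \<times> nat list \<times> nat"

definition side_branch :: "nat \<Rightarrow> side_data \<Rightarrow> int list \<Rightarrow> side_node rtree" where
  "side_branch p B \<kappa> =
    (case B of (F, T) \<Rightarrow> attach F (leaves F) (\<lambda>w. tree_prod (Tzp p) (T w \<kappa>)))"


section \<open>Trees of level \<open>d\<close>\<close>

definition mod_rel :: "int \<Rightarrow> (int \<times> int) set" where
  "mod_rel \<rho> = {(x, y). [x = y] (mod \<rho>)}"

definition bone_params ::
    "int list set \<Rightarrow> nat rtree \<Rightarrow> bone_lengths \<Rightarrow> nat \<times> nat \<Rightarrow> int set \<Rightarrow> int list set" where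
  "bone_params M S l e \<Xi> = {\<kappa> @ [\<mu>] | \<kappa> \<mu>. \<kappa> \<in> M \<and> \<mu> \<in> \<Xi> \<and>
     joint_depth M S l (fst e) \<kappa> < Fin \<mu> \<and> Fin \<mu> < joint_depth M S l (snd e) \<kappa>}"

definition datum_tree ::
    "nat \<Rightarrow> int \<Rightarrow> int list set \<Rightarrow> nat rtree \<Rightarrow> bone_lengths \<Rightarrow> (nat \<Rightarrow> side_data) \<Rightarrow>
     (nat \<times> nat \<Rightarrow> int set \<Rightarrow> side_data) \<Rightarrow> int list \<Rightarrow> (skel_node + skel_node \<times> side_node) rtree"
  where
  "datum_tree p \<rho> M S l Bj Bb \<kappa> =
    (let T0 = skeleton M S l \<kappa> in
     attach T0 (nodes T0)
       (\<lambda>v. case v of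
              Inl w \<Rightarrow> side_branch p (Bj w) \<kappa>
            | Inr (e, i) \<Rightarrow>
                let \<mu> = int (depth T0 v) in side_branch p (Bb e (mod_rel \<rho> `` {\<mu>})) (\<kappa> @ [\<mu>])))"

definition parametrized_tree :: "nat \<Rightarrow> int list set \<Rightarrow> (int list \<Rightarrow> 'a rtree) \<Rightarrow> bool" where
  "parametrized_tree m M T \<longleftrightarrow> definable m M \<and> (\<forall>\<kappa>\<in>M. rooted_tree (T \<kappa>))"

text \<open>
  \<open>nat_level_tree p d m M T\<close>: the parametrized tree \<open>T\<close> on \<open>M \<subseteq> \<Gamma>\<^sup>m\<close>, with nodes in \<^typ>\<open>nat\<close>,
  is of level \<open>d\<close>. Trees of level \<open>d\<close> are countable, so fixing the type of the nodes of the trees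
  occurring in side branch data is no restriction up to isomorphism.
\<close>

primrec nat_level_tree ::
    "nat \<Rightarrow> nat \<Rightarrow> nat \<Rightarrow> int list set \<Rightarrow> (int list \<Rightarrow> nat rtree) \<Rightarrow> bool" where
  "nat_level_tree p 0 = (\<lambda>m M T.
     parametrized_tree m M T \<and>
     (\<exists>S l. level0_datum m M S l \<and> (\<forall>\<kappa>\<in>M. tree_iso (T \<kappa>) (skeleton M S l \<kappa>))))"
| "nat_level_tree p (Suc d) = (\<lambda>m M T.
     parametrized_tree m M T \<and>
     (\<exists>\<rho> S l Bj Bb.
        0 < \<rho> \<and> level0_datum m M S l \<and>
        (\<forall>e\<in>edges S. \<forall>\<kappa>\<in>M. \<forall>\<kappa>'\<in>M. \<forall>z z'.
           l e \<kappa> = Fin z \<longrightarrow> l e \<kappa>' = Fin z' \<longrightarrow> z mod \<rho> = z' mod \<rho>) \<and>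
        (\<forall>w\<in>real_joints M S l. side_branch_datum (nat_level_tree p d m M) M (Bj w)) \<and>
        (\<forall>e\<in>edges S. \<forall>\<Xi>\<in>UNIV // mod_rel \<rho>.
           side_branch_datum (nat_level_tree p d (Suc m) (bone_params M S l e \<Xi>))
             (bone_params M S l e \<Xi>) (Bb e \<Xi>)) \<and>
        (\<forall>\<kappa>\<in>M. tree_iso (T \<kappa>) (datum_tree p \<rho> M S l Bj Bb \<kappa>))))"

definition level_tree ::
    "nat \<Rightarrow> nat \<Rightarrow> nat \<Rightarrow> int list set \<Rightarrow> (int list \<Rightarrow> 'a rtree) \<Rightarrow> bool" where
  "level_tree p d m M T \<longleftrightarrow>
    parametrized_tree m M T \<and>
    (\<exists>T'. nat_level_tree p d m M T' \<and> (\<forall>\<kappa>\<in>M. tree_iso (T \<kappa>) (T' \<kappa>)))"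

definition unparametrized_level_tree :: "nat \<Rightarrow> nat \<Rightarrow> 'a rtree \<Rightarrow> bool" where
  "unparametrized_level_tree p d T \<longleftrightarrow> level_tree p d 0 {[]} (\<lambda>_. T)"


section \<open>Poincare series\<close>

text \<open>
  Trees of level \<open>d\<close> have finitely many nodes of each depth, so \<^const>\<open>card\<close> is the true number
  of nodes here.
\<close>

definition poincare_series :: "'a rtree \<Rightarrow> int fps" where
  "poincare_series T = Abs_fps (\<lambda>n. int (card {v \<in> nodes T. depth T v = n}))"

text \<open>
  \<open>\<int>[[Z]]\<close> and \<open>\<rat>(Z)\<close> are both regarded as subsets of the field \<open>\<rat>((Z))\<close>, i.e. \<^typ>\<open>rat fls\<close>.
\<close>

definition rational_series :: "int fps \<Rightarrow> bool" where
  "rational_series P \<longleftrightarrow>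
    (\<exists>f g :: rat poly. g \<noteq> 0 \<and>
       fps_to_fls (Abs_fps (\<lambda>n. of_int (fps_nth P n))) =
       fps_to_fls (fps_of_poly f) / fps_to_fls (fps_of_poly g))"

end

theory Submission
  imports Defs
begin

text \<open>
  Consider level counts \<open>h(\<kappa>, n)\<close> of a parametrized tree on \<open>M\<close> such that, for every affine map
  \<open>\<phi> : \<nat>\<^sup>k \<rightarrow> M\<close> and all monomials \<open>c\<^sub>i Z\<^bsup>e\<^sub>i\<^esup>\<close> with \<open>e\<^sub>i > 0\<close>, the series
  \<open>\<Sum>\<^sub>t \<Sum>\<^sub>n \<Prod>\<^sub>i (c\<^sub>i Z\<^bsup>e\<^sub>i\<^esup>)\<^bsup>t\<^sub>i\<^esup> (qZ)\<^sup>n h(\<phi> t, n)\<close> is rational. This property passes from level \<open>d\<close> to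
  level \<open>d + 1\<close>. The product with \<open>T(\<int>\<^sub>p)\<close> only replaces \<open>q\<close> by \<open>pq\<close>. A side branch at depth \<open>D(t)\<close>
  contributes a factor \<open>(qZ)\<^bsup>D(t)\<^esup>\<close>, which is absorbed into the monomials because \<open>D\<close> is affine with
  coefficients in \<open>\<nat>\<close>. On a bone, the nodes in a fixed class modulo \<open>\<rho>\<close> have depths
  \<open>D(t) + 1 + j + \<rho>s\<close>, where \<open>s\<close> ranges over \<open>\<nat>\<close> or over \<open>0 \<le> s < L(t)\<close>; since all lengths are
  constant modulo \<open>\<rho>\<close>, \<open>L\<close> is again affine with coefficients in \<open>\<nat>\<close>, so that \<open>{(t, s). s < L(t)}\<close> is a
  finite disjoint union of affine images of \<open>\<nat>\<^sup>k\<close> and \<open>\<nat>\<^bsup>k+1\<^esup>\<close>.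
\<close>


section \<open>Weighted sums over \<open>\<nat>\<^sup>k\<close>\<close>

definition rational_fps :: "rat fps \<Rightarrow> bool" where
  "rational_fps F \<longleftrightarrow> (\<exists>f g :: rat poly. g \<noteq> 0 \<and> fps_of_poly g * F = fps_of_poly f)"

lemma rational_fps_poly: "rational_fps (fps_of_poly f)"
  unfolding rational_fps_def by (rule exI[of _ f], rule exI[of _ 1]) simp

lemma rational_fps_0: "rational_fps 0"
  using rational_fps_poly[of 0] by simp

lemma rational_fps_add:
  assumes "rational_fps F" "rational_fps G"
  shows "rational_fps (F + G)"
proof -
  obtain f g f' g' :: "rat poly" where *: "g \<noteq> 0" "fps_of_poly g * F = fps_of_poly f"
    "g' \<noteq> 0" "fps_of_poly g' * G = fps_of_poly f'"
    using assms unfolding rational_fps_def by blast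
  have "fps_of_poly (g * g') * (F + G) =
      fps_of_poly g' * (fps_of_poly g * F) + fps_of_poly g * (fps_of_poly g' * G)"
    by (simp add: fps_of_poly_mult algebra_simps)
  also have "\<dots> = fps_of_poly (g' * f + g * f')"
    by (simp only: * fps_of_poly_mult fps_of_poly_add)
  finally show ?thesis
    unfolding rational_fps_def using * by (metis mult_eq_0_iff)
qed

lemma rational_fps_mult_poly:
  assumes "rational_fps F"
  shows "rational_fps (fps_of_poly h * F)"
proof -
  obtain f g :: "rat poly" where *: "g \<noteq> 0" "fps_of_poly g * F = fps_of_poly f"
    using assms unfolding rational_fps_def by blast
  have "fps_of_poly g * (fps_of_poly h * F) = fps_of_poly (h * f)"
    by (simp add: fps_of_poly_mult flip: *(2))
  then show ?thesis
    unfolding rational_fps_def using * by metis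
qed

text \<open>This is the step that creates denominators: a recursion makes \<open>h * F\<close>
  rational for \<open>h = 1 - c Z^e\<close>, and \<open>h\<close> is then divided out.\<close>

lemma rational_fps_div_poly:
  assumes "rational_fps (fps_of_poly h * F)" "h \<noteq> 0"
  shows "rational_fps F"
proof -
  obtain f g :: "rat poly" where *: "g \<noteq> 0" "fps_of_poly g * (fps_of_poly h * F) = fps_of_poly f"
    using assms unfolding rational_fps_def by blast
  then have "fps_of_poly (g * h) * F = fps_of_poly f"
    by (simp add: fps_of_poly_mult mult.assoc)
  then show ?thesis
    unfolding rational_fps_def using * assms(2) by (metis mult_eq_0_iff)
qed

lemma rational_fps_mult_monom:
  assumes "rational_fps F"
  shows "rational_fps (fps_const a * fps_X ^ n * F)"
  using rational_fps_mult_poly[OF assms, of "monom a n"] by (simp add: fps_of_poly_monom)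

section \<open>Monomial weights on \<nat>^k and their generating series\<close>

definition tuples :: "nat \<Rightarrow> (nat \<Rightarrow> nat) set" where
  "tuples k = {t. \<forall>i\<ge>k. t i = 0}"

text \<open>Serves twice: as the exponent of \<open>Z\<close> in a product of monomials, and as the
  linear part of affine functions with coefficients in \<nat>.\<close>

definition wdeg :: "nat \<Rightarrow> (nat \<Rightarrow> nat) \<Rightarrow> (nat \<Rightarrow> nat) \<Rightarrow> nat" where
  "wdeg k e t = (\<Sum>i<k. e i * t i)"

definition wval :: "nat \<Rightarrow> (nat \<Rightarrow> rat) \<Rightarrow> (nat \<Rightarrow> nat) \<Rightarrow> rat" where
  "wval k c t = (\<Prod>i<k. c i ^ t i)"

definition fiber :: "nat \<Rightarrow> (nat \<Rightarrow> nat) \<Rightarrow> nat \<Rightarrow> ((nat \<Rightarrow> nat) \<times> nat) set" where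
  "fiber k e N = {(t, n). t \<in> tuples k \<and> wdeg k e t + n = N}"

text \<open>Given by coefficients, so that no infinite sum has to be formed; the coefficient sums
  are finite as soon as all \<open>e i\<close> with \<open>i < k\<close> are positive
  (\<open>finite_fiber\<close>).\<close>

definition wseries ::
    "nat \<Rightarrow> (nat \<Rightarrow> rat) \<Rightarrow> (nat \<Rightarrow> nat) \<Rightarrow> rat \<Rightarrow> ((nat \<Rightarrow> nat) \<Rightarrow> nat \<Rightarrow> rat) \<Rightarrow> rat fps" where
  "wseries k c e q g = Abs_fps (\<lambda>N. \<Sum>(t, n)\<in>fiber k e N. wval k c t * q ^ n * g t n)"

text \<open>
  Quantifying over all monomials \<open>c\<^sub>i Z\<^bsup>e\<^sub>i\<^esup>\<close> that may be substituted for the variables makes the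
  property stable under affine reparametrizations; \<open>e\<^sub>i > 0\<close> makes the coefficients of the
  series finite sums.
\<close>

definition rational_sums :: "nat \<Rightarrow> ((nat \<Rightarrow> nat) \<Rightarrow> nat \<Rightarrow> rat) \<Rightarrow> bool" where
  "rational_sums k g \<longleftrightarrow> (\<forall>c e q. (\<forall>i<k. 0 < e i) \<longrightarrow> rational_fps (wseries k c e q g))"

lemma wdeg_Suc: "wdeg (Suc k) e t = wdeg k e t + e k * t k"
  by (simp add: wdeg_def)

lemma wval_Suc: "wval (Suc k) c t = wval k c t * c k ^ t k"
  by (simp add: wval_def)

lemma wdeg_cong: "(\<And>i. i < k \<Longrightarrow> e i = e' i) \<Longrightarrow> (\<And>i. i < k \<Longrightarrow> t i = t' i) \<Longrightarrow> wdeg k e t = wdeg k e' t'"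
  by (simp add: wdeg_def)

lemma wval_cong: "(\<And>i. i < k \<Longrightarrow> c i = c' i) \<Longrightarrow> (\<And>i. i < k \<Longrightarrow> t i = t' i) \<Longrightarrow> wval k c t = wval k c' t'"
  by (simp add: wval_def)

lemma wdeg_add: "wdeg k (\<lambda>i. e i + a i) t = wdeg k e t + wdeg k a t"
  by (simp add: wdeg_def sum.distrib algebra_simps)

text \<open>Together with \<open>wdeg_add\<close>: multiplying the \<open>i\<close>-th monomial by
  \<open>(q Z)^(a i)\<close> for each \<open>i\<close> multiplies the weight of \<open>t\<close> by
  \<open>(q Z)^(wdeg k a t)\<close>.\<close>

lemma wval_mult: "wval k (\<lambda>i. c i * q ^ a i) t = wval k c t * q ^ wdeg k a t"
  by (simp add: wval_def wdeg_def power_mult_distrib prod.distrib power_mult power_sum)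

lemma wdeg_upd:
  assumes "i < k"
  shows "wdeg k e (t(i := t i + x)) = wdeg k e t + e i * x"
proof -
  have "wdeg k e (t(i := t i + x)) = e i * (t i + x) + (\<Sum>j\<in>{..<k} - {i}. e j * t j)"
    unfolding wdeg_def by (subst sum.remove[of _ i]) (use assms in \<open>auto intro!: sum.cong\<close>)
  also have "\<dots> = wdeg k e t + e i * x"
    unfolding wdeg_def by (subst sum.remove[of _ i]) (use assms in \<open>auto simp: algebra_simps\<close>)
  finally show ?thesis .
qed

lemma wval_upd:
  assumes "i < k"
  shows "wval k c (t(i := t i + x)) = wval k c t * c i ^ x"
proof -
  have "wval k c (t(i := t i + x)) = c i ^ (t i + x) * (\<Prod>j\<in>{..<k} - {i}. c j ^ t j)"
    unfolding wval_def by (subst prod.remove[of _ i]) (use assms in \<open>auto intro!: prod.cong\<close>)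
  also have "\<dots> = wval k c t * c i ^ x"
    unfolding wval_def by (subst prod.remove[of _ i]) (use assms in \<open>auto simp: power_add\<close>)
  finally show ?thesis .
qed

lemma wdeg_le:
  assumes "0 < e i" "i < k"
  shows "t i \<le> wdeg k e t"
proof -
  have "t i \<le> e i * t i"
    using assms(1) by simp
  also have "\<dots> \<le> wdeg k e t"
    unfolding wdeg_def by (rule member_le_sum) (use assms(2) in auto)
  finally show ?thesis .
qed

lemma finite_tuples_wdeg:
  assumes "\<And>i. i < k \<Longrightarrow> 0 < e i"
  shows "finite {t \<in> tuples k. wdeg k e t \<le> N}"
proof (rule finite_subset)
  show "{t \<in> tuples k. wdeg k e t \<le> N} \<subseteq> {t. \<forall>i. (i \<in> {..<k} \<longrightarrow> t i \<in> {..N}) \<and> (i \<notin> {..<k} \<longrightarrow> t i = 0)}"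
    by (auto simp: tuples_def intro: order_trans[OF wdeg_le] assms)
qed (rule finite_set_of_finite_funs; simp)

lemma finite_fiber:
  assumes "\<And>i. i < k \<Longrightarrow> 0 < e i"
  shows "finite (fiber k e N)"
proof (rule finite_subset)
  show "fiber k e N \<subseteq> {t \<in> tuples k. wdeg k e t \<le> N} \<times> {..N}"
    by (auto simp: fiber_def)
qed (use finite_tuples_wdeg[OF assms] in auto)

text \<open>Target form of the reindexings below: a monomial in front of the series amounts to a
  constant \<open>b\<close> in the degree condition. For \<open>b > N\<close> both sides are
  zero.\<close>

lemma wseries_monom_nth:
  "(fps_const a * fps_X ^ b * wseries k c e q g) $ N =
    (\<Sum>(t, n)\<in>{(t, n). t \<in> tuples k \<and> b + wdeg k e t + n = N}. a * (wval k c t * q ^ n * g t n))"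
proof (cases "b \<le> N")
  case True
  then have "{(t, n). t \<in> tuples k \<and> b + wdeg k e t + n = N} = fiber k e (N - b)"
    by (auto simp: fiber_def)
  with True show ?thesis
    by (simp add: mult.assoc fps_X_power_mult_nth wseries_def case_prod_beta sum_distrib_left)
next
  case False
  then have empty: "{(t, n). t \<in> tuples k \<and> b + wdeg k e t + n = N} = {}"
    by auto
  from False show ?thesis
    by (simp only: empty sum.empty) (simp add: mult.assoc fps_X_power_mult_nth)
qed

section \<open>Closure properties of rational sums\<close>

lemma rational_sums_cong:
  assumes "\<And>t n. t \<in> tuples k \<Longrightarrow> g t n = g' t n"
  shows "rational_sums k g \<longleftrightarrow> rational_sums k g'"
proof -
  have "wseries k c e q g = wseries k c e q g'" for c e q
    by (rule fps_ext) (auto simp: wseries_def fiber_def assms intro!: sum.cong)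
  then show ?thesis by (simp add: rational_sums_def)
qed

lemma rational_sums_0: "rational_sums k (\<lambda>t n. 0)"
proof -
  have "wseries k c e q (\<lambda>t n. 0) = 0" for c e q
    by (rule fps_ext) (simp add: wseries_def)
  then show ?thesis
    by (simp add: rational_sums_def rational_fps_0)
qed

lemma rational_sums_add:
  assumes "rational_sums k g" "rational_sums k g'"
  shows "rational_sums k (\<lambda>t n. g t n + g' t n)"
proof -
  have "wseries k c e q (\<lambda>t n. g t n + g' t n) = wseries k c e q g + wseries k c e q g'" for c e q
    by (rule fps_ext) (simp add: wseries_def distrib_left case_prod_beta sum.distrib)
  with assms show ?thesis
    by (simp add: rational_sums_def rational_fps_add)
qed

lemma rational_sums_sum:
  assumes "finite A" "\<And>x. x \<in> A \<Longrightarrow> rational_sums k (g x)"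
  shows "rational_sums k (\<lambda>t n. \<Sum>x\<in>A. g x t n)"
  using assms by (induction A rule: finite_induct) (auto intro: rational_sums_0 rational_sums_add)

text \<open>The factor \<open>r ^ n\<close> is absorbed by passing from \<open>q\<close> to
  \<open>q * r\<close>; this is what the quantification over \<open>q\<close> in
  \<open>rational_sums\<close> is for.\<close>

lemma rational_sums_power:
  assumes "rational_sums k g"
  shows "rational_sums k (\<lambda>t n. r ^ n * g t n)"
proof -
  have "wseries k c e q (\<lambda>t n. r ^ n * g t n) = wseries k c e (q * r) g" for c e q
    by (rule fps_ext) (simp add: wseries_def power_mult_distrib mult.assoc)
  with assms show ?thesis
    by (simp add: rational_sums_def)
qed

lemma tuples_0: "tuples 0 = {\<lambda>i. 0}"
  by (auto simp: tuples_def)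

text \<open>Geometric summation over \<open>t k\<close>: lowering \<open>t k\<close> by one matches
  the tuples of degree \<open>N\<close> with \<open>t k > 0\<close> with all tuples of degree
  \<open>N - e k\<close>, so that after multiplication by \<open>1 - c k * Z^(e k)\<close> only
  \<open>t k = 0\<close> survives.\<close>

lemma wseries_delta_Suc:
  fixes e :: "nat \<Rightarrow> nat"
  assumes e: "\<And>i. i < Suc k \<Longrightarrow> 0 < e i"
  shows "(1 - fps_const (c k) * fps_X ^ e k) * wseries (Suc k) c e q (\<lambda>t n. if n = 0 then 1 else 0)
    = wseries k c e q (\<lambda>t n. if n = 0 then 1 else 0)"
proof (rule fps_ext)
  fix N
  let ?d = "\<lambda>(t :: nat \<Rightarrow> nat) n :: nat. if n = 0 then 1 else 0 :: rat"
  \<comment> \<open>The delta function leaves only \<open>n = 0\<close>, so the coefficient of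
    \<open>Z^N\<close> is a sum over tuples of degree exactly \<open>N\<close>.\<close>
  define T where "T = (\<lambda>k N. {t \<in> tuples k. wdeg k e t = N})"
  have fin: "finite (T k' N)" if "k' \<le> Suc k" for k' N
    unfolding T_def
    by (rule finite_subset[OF _ finite_tuples_wdeg[where k = k' and e = e and N = N]]) (use e that in auto)
  have nth: "wseries k c e q ?d $ N = (\<Sum>t\<in>T k N. wval k c t)" if e': "\<And>i. i < k \<Longrightarrow> 0 < e i" for k N
  proof -
    have "wseries k c e q ?d $ N = (\<Sum>(t, n)\<in>fiber k e N. wval k c t * q ^ n * ?d t n)"
      by (simp add: wseries_def)
    also have "\<dots> = (\<Sum>(t, n)\<in>{(t, n) \<in> fiber k e N. n = 0}. wval k c t)"
      by (rule sum.mono_neutral_cong_right) (use finite_fiber[of k e N] e' in \<open>auto split: if_splits\<close>)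
    also have "\<dots> = (\<Sum>t\<in>T k N. wval k c t)"
      by (rule sum.reindex_bij_witness[of _ "\<lambda>t. (t, 0)" fst]) (auto simp: T_def fiber_def)
    finally show ?thesis .
  qed
  have split: "T (Suc k) N = T k N \<union> {t \<in> T (Suc k) N. 0 < t k}"
  proof (intro equalityI subsetI)
    fix t assume t: "t \<in> T (Suc k) N"
    have "t \<in> tuples k" if "t k = 0"
      using t that by (auto simp: T_def tuples_def) (metis le_neq_implies_less Suc_leI)
    with t show "t \<in> T k N \<union> {t \<in> T (Suc k) N. 0 < t k}"
      by (cases "t k = 0") (auto simp: T_def wdeg_Suc)
  qed (auto simp: T_def tuples_def wdeg_Suc)
  have "(\<Sum>t\<in>T (Suc k) N. wval (Suc k) c t) =
      (\<Sum>t\<in>T k N. wval (Suc k) c t) + (\<Sum>t\<in>{t \<in> T (Suc k) N. 0 < t k}. wval (Suc k) c t)"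
  proof (subst split, rule sum.union_disjoint)
    show "finite {t \<in> T (Suc k) N. 0 < t k}"
      by (rule finite_subset[OF _ fin[OF order_refl]]) auto
  qed (use fin[of k] in \<open>auto simp: T_def tuples_def\<close>)
  also have "(\<Sum>t\<in>T k N. wval (Suc k) c t) = (\<Sum>t\<in>T k N. wval k c t)"
    by (rule sum.cong) (auto simp: T_def tuples_def wval_Suc)
  also have "(\<Sum>t\<in>{t \<in> T (Suc k) N. 0 < t k}. wval (Suc k) c t) =
      (if e k \<le> N then c k * (\<Sum>t\<in>T (Suc k) (N - e k). wval (Suc k) c t) else 0)"
  proof (cases "e k \<le> N")
    case True
    have pos: "t(k := Suc (t k)) \<in> T (Suc k) N" if "t \<in> T (Suc k) (N - e k)" for t
      using that True wdeg_upd[of k "Suc k" e t 1] by (auto simp: T_def tuples_def)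
    have neg: "t(k := t k - 1) \<in> T (Suc k) (N - e k)" if "t \<in> T (Suc k) N" "0 < t k" for t
      using that True wdeg_upd[of k "Suc k" e "t(k := t k - 1)" 1] by (auto simp: T_def tuples_def)
    have "(\<Sum>t\<in>{t \<in> T (Suc k) N. 0 < t k}. wval (Suc k) c t) =
        (\<Sum>t\<in>T (Suc k) (N - e k). c k * wval (Suc k) c t)"
    proof (rule sum.reindex_bij_witness[of _ "\<lambda>t. t(k := Suc (t k))" "\<lambda>t. t(k := t k - 1)"], goal_cases)
      case (5 t)
      then show ?case
        using wval_upd[of k "Suc k" c "t(k := t k - 1)" 1] by simp
    qed (use pos neg in auto)
    with True show ?thesis
      by (simp add: sum_distrib_left)
  next
    case False
    have "t \<notin> T (Suc k) N" if "0 < t k" for t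
    proof -
      have "e k \<le> e k * t k" using that by simp
      also have "\<dots> \<le> wdeg (Suc k) e t" by (simp add: wdeg_Suc)
      finally show ?thesis using False by (auto simp: T_def)
    qed
    then have "{t \<in> T (Suc k) N. 0 < t k} = {}"
      by blast
    with False show ?thesis
      by (simp only: sum.empty) simp
  qed
  finally show "((1 - fps_const (c k) * fps_X ^ e k) * wseries (Suc k) c e q ?d) $ N = wseries k c e q ?d $ N"
    using e by (simp add: left_diff_distrib mult.assoc fps_X_power_mult_nth nth not_le)
qed

text \<open>The series is the product of the geometric series \<open>1 / (1 - c i * Z^(e i))\<close>
  over \<open>i < k\<close>; one factor is removed per induction step.\<close>

lemma rational_sums_delta: "rational_sums k (\<lambda>t n. if n = 0 then 1 else 0)"
proof -
  let ?d = "\<lambda>(t :: nat \<Rightarrow> nat) n :: nat. if n = 0 then 1 else 0 :: rat"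
  have "rational_fps (wseries k c e q ?d)" if "\<forall>i<k. 0 < e i"
    for c :: "nat \<Rightarrow> rat" and e :: "nat \<Rightarrow> nat" and q :: rat
    using that
  proof (induction k)
    case 0
    have "wseries 0 c e q ?d = 1"
      by (rule fps_ext) (auto simp: wseries_def fiber_def tuples_0 wdeg_def wval_def Collect_conv_if
          split: prod.splits cong: conj_cong intro!: sum.neutral)
    then show ?case
      using rational_fps_poly[of 1] by simp
  next
    case (Suc k)
    let ?h = "1 - monom (c k) (e k)"
    \<comment> \<open>\<open>0 < e k\<close> enters here: the monomial has no constant term, so the
      factor is nonzero even for \<open>c k = 1\<close>.\<close>
    have "coeff ?h 0 = 1"
      using Suc.prems by auto
    then have "?h \<noteq> 0" by (metis coeff_0 zero_neq_one)
    moreover have "fps_of_poly ?h = 1 - fps_const (c k) * fps_X ^ e k"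
      by (simp add: fps_of_poly_diff fps_of_poly_monom)
    then have "fps_of_poly ?h * wseries (Suc k) c e q ?d = wseries k c e q ?d"
      using wseries_delta_Suc[of k e c q] Suc.prems by (simp only:)
    ultimately show ?case
      using Suc rational_fps_div_poly by (metis less_SucI)
  qed
  then show ?thesis
    by (simp add: rational_sums_def)
qed

text \<open>Substituting \<open>n = D t + n'\<close> splits off \<open>(q Z)^(D t)\<close>, which is
  \<open>(q Z)^b\<close> times the factors \<open>(q Z)^(a i * t i)\<close>. The latter join the
  monomials of the \<open>t i\<close>, whose exponents \<open>e i + a i\<close> stay
  positive.\<close>

lemma rational_sums_shift:
  assumes g: "rational_sums k g" and D: "\<And>t. D t = b + wdeg k a t"
  shows "rational_sums k (\<lambda>t n. if D t \<le> n then g t (n - D t) else 0)"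
  unfolding rational_sums_def
proof (intro allI impI)
  fix c :: "nat \<Rightarrow> rat" and e :: "nat \<Rightarrow> nat" and q :: rat
  assume e: "\<forall>i<k. 0 < e i"
  let ?f = "\<lambda>t n. if D t \<le> n then g t (n - D t) else 0"
  let ?c = "\<lambda>i. c i * q ^ a i" and ?e = "\<lambda>i. e i + a i"
  have "wseries k c e q ?f = fps_const (q ^ b) * fps_X ^ b * wseries k ?c ?e q g"
  proof (rule fps_ext)
    fix N
    have "wseries k c e q ?f $ N = (\<Sum>(t, n)\<in>fiber k e N. wval k c t * q ^ n * ?f t n)"
      by (simp add: wseries_def)
    also have "\<dots> = (\<Sum>(t, n)\<in>{(t, n) \<in> fiber k e N. D t \<le> n}. wval k c t * q ^ n * g t (n - D t))"
      by (rule sum.mono_neutral_cong_right) (use finite_fiber[of k e] e in \<open>auto split: if_splits\<close>)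
    also have "\<dots> = (\<Sum>(t, n)\<in>{(t, n). t \<in> tuples k \<and> b + wdeg k ?e t + n = N}. q ^ b * (wval k ?c t * q ^ n * g t n))"
      by (rule sum.reindex_bij_witness[of _ "\<lambda>(t, n). (t, D t + n)" "\<lambda>(t, n). (t, n - D t)"])
        (auto simp: fiber_def D wdeg_add wval_mult power_add simp flip: power_add)
    also have "\<dots> = (fps_const (q ^ b) * fps_X ^ b * wseries k ?c ?e q g) $ N"
      by (simp only: wseries_monom_nth)
    finally show "wseries k c e q ?f $ N = (fps_const (q ^ b) * fps_X ^ b * wseries k ?c ?e q g) $ N" .
  qed
  with g e show "rational_fps (wseries k c e q ?f)"
    by (simp add: rational_sums_def rational_fps_mult_monom)
qed

text \<open>Tuples of \<nat>^k vanish in slot \<open>k\<close>, so this slot can take up one more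
  variable; the reindexings below write it there and reset it to \<open>0\<close> on the way
  back.\<close>

lemma tuples_upd: "t \<in> tuples (Suc k) \<Longrightarrow> t(k := 0) \<in> tuples k"
  "t \<in> tuples k \<Longrightarrow> t(k := s) \<in> tuples (Suc k)"
  "t \<in> tuples k \<Longrightarrow> i < k \<Longrightarrow> t(i := s) \<in> tuples k"
  "t \<in> tuples k \<Longrightarrow> t k = 0"
  by (auto simp: tuples_def)

lemma wdeg_upd_same: "wdeg k e (t(k := s)) = wdeg k e t" "wdeg k (e(k := z)) t = wdeg k e t"
  by (rule wdeg_cong; auto)+

lemma wval_upd_same: "wval k c (t(k := s)) = wval k c t" "wval k (c(k := z)) t = wval k c t"
  by (rule wval_cong; auto)+

text \<open>The index \<open>s\<close> becomes an additional variable in slot \<open>k\<close> with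
  monomial \<open>(q Z)^m\<close>, whose exponent is positive because \<open>0 < m\<close>. This
  sums over the nodes of an infinite bone.\<close>

lemma rational_sums_unbounded:
  assumes g: "rational_sums (Suc k) g" and "0 < m" and D: "\<And>t. D t = b + wdeg k a t"
  shows "rational_sums k (\<lambda>t n. \<Sum>s | D t + m * s \<le> n. g (t(k := s)) (n - (D t + m * s)))"
  unfolding rational_sums_def
proof (intro allI impI)
  fix c :: "nat \<Rightarrow> rat" and e :: "nat \<Rightarrow> nat" and q :: rat
  assume e: "\<forall>i<k. 0 < e i"
  let ?f = "\<lambda>t n. \<Sum>s | D t + m * s \<le> n. g (t(k := s)) (n - (D t + m * s))"
  let ?c = "(\<lambda>i. c i * q ^ a i)(k := q ^ m)" and ?e = "(\<lambda>i. e i + a i)(k := m)"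
  have fin: "finite {s. D t + m * s \<le> n}" for t n
  proof (rule finite_subset)
    show "{s. D t + m * s \<le> n} \<subseteq> {..n}"
    proof
      fix s assume "s \<in> {s. D t + m * s \<le> n}"
      moreover have "s \<le> m * s"
        using \<open>0 < m\<close> by simp
      ultimately show "s \<in> {..n}"
        unfolding mem_Collect_eq atMost_iff by linarith
    qed
  qed simp
  have "wseries k c e q ?f = fps_const (q ^ b) * fps_X ^ b * wseries (Suc k) ?c ?e q g"
  proof (rule fps_ext)
    fix N
    have "wseries k c e q ?f $ N = (\<Sum>x\<in>fiber k e N. \<Sum>s | D (fst x) + m * s \<le> snd x.
        wval k c (fst x) * q ^ snd x * g ((fst x)(k := s)) (snd x - (D (fst x) + m * s)))"
      by (simp add: wseries_def case_prod_beta sum_distrib_left)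
    also have "\<dots> = (\<Sum>((t, n), s)\<in>(SIGMA x:fiber k e N. {s. D (fst x) + m * s \<le> snd x}).
        wval k c t * q ^ n * g (t(k := s)) (n - (D t + m * s)))"
      by (subst sum.Sigma) (use finite_fiber[of k e] e fin in \<open>auto simp: case_prod_beta\<close>)
    also have "\<dots> = (\<Sum>(t, n)\<in>{(t, n). t \<in> tuples (Suc k) \<and> b + wdeg (Suc k) ?e t + n = N}.
        q ^ b * (wval (Suc k) ?c t * q ^ n * g t n))"
      by (rule sum.reindex_bij_witness[of _
            "\<lambda>(t, n). ((t(k := 0), D t + m * t k + n), t k)" "\<lambda>((t, n), s). (t(k := s), n - (D t + m * s))"])
        (auto simp: fiber_def D wdeg_add wval_mult wdeg_Suc wval_Suc wdeg_upd_same wval_upd_same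
          tuples_upd power_mult[symmetric] simp flip: power_add)
    also have "\<dots> = (fps_const (q ^ b) * fps_X ^ b * wseries (Suc k) ?c ?e q g) $ N"
      by (simp only: wseries_monom_nth)
    finally show "wseries k c e q ?f $ N = (fps_const (q ^ b) * fps_X ^ b * wseries (Suc k) ?c ?e q g) $ N" .
  qed
  with g e \<open>0 < m\<close> show "rational_fps (wseries k c e q ?f)"
    by (simp add: rational_sums_def rational_fps_mult_monom less_Suc_eq)
qed

text \<open>The pairs \<open>u < t i\<close> are parametrized freely by two natural numbers via
  \<open>t i = v + 1 + u\<close>. The power of the \<open>i\<close>-th monomial then splits into a
  power for \<open>v\<close>, one for \<open>u\<close>, and a single factor in front;
  \<open>v\<close> stays in slot \<open>i\<close> and \<open>u\<close> goes to slot
  \<open>k\<close>.\<close>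

lemma rational_sums_block:
  assumes g: "rational_sums (Suc k) g" and i: "i < k"
  shows "rational_sums k (\<lambda>t n. \<Sum>u<t i. g (t(i := t i - Suc u, k := u)) n)"
  unfolding rational_sums_def
proof (intro allI impI)
  fix c :: "nat \<Rightarrow> rat" and e :: "nat \<Rightarrow> nat" and q :: rat
  assume e: "\<forall>i<k. 0 < e i"
  let ?f = "\<lambda>t n. \<Sum>u<t i. g (t(i := t i - Suc u, k := u)) n"
  let ?c = "c(k := c i)" and ?e = "e(k := e i)"
  have deg: "wdeg k e t = wdeg k e (t(i := t i - Suc u)) + e i * Suc u" if "u < t i" for t u
    using wdeg_upd[OF i, of e "t(i := t i - Suc u)" "Suc u"] that by simp
  have val: "wval k c t = wval k c (t(i := t i - Suc u)) * c i ^ Suc u" if "u < t i" for t u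
    using wval_upd[OF i, of c "t(i := t i - Suc u)" "Suc u"] that by simp
  have "wseries k c e q ?f = fps_const (c i) * fps_X ^ e i * wseries (Suc k) ?c ?e q g"
  proof (rule fps_ext)
    fix N
    have "wseries k c e q ?f $ N = (\<Sum>x\<in>fiber k e N. \<Sum>u<fst x i.
        wval k c (fst x) * q ^ snd x * g ((fst x)(i := fst x i - Suc u, k := u)) (snd x))"
      by (simp add: wseries_def case_prod_beta sum_distrib_left)
    also have "\<dots> = (\<Sum>((t, n), u)\<in>(SIGMA x:fiber k e N. {..<fst x i}).
        wval k c t * q ^ n * g (t(i := t i - Suc u, k := u)) n)"
      by (subst sum.Sigma) (use finite_fiber[of k e] e in \<open>auto simp: case_prod_beta\<close>)
    also have "\<dots> = (\<Sum>(t, n)\<in>{(t, n). t \<in> tuples (Suc k) \<and> e i + wdeg (Suc k) ?e t + n = N}.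
        c i * (wval (Suc k) ?c t * q ^ n * g t n))"
    proof (rule sum.reindex_bij_witness[of _
            "\<lambda>(t, n). ((t(k := 0, i := t i + Suc (t k)), n), t k)"
            "\<lambda>((t, n), u). (t(i := t i - Suc u, k := u), n)"], goal_cases)
      case (4 y)
      obtain t n where y: "y = (t, n)" by force
      have "wdeg k e (t(k := 0, i := t i + Suc (t k))) = wdeg k e t + e i * Suc (t k)"
        using wdeg_upd[OF i, of e "t(k := 0)" "Suc (t k)"] i by (simp add: wdeg_upd_same)
      with 4 y i show ?case
        by (auto simp: fiber_def wdeg_Suc wdeg_upd_same tuples_upd)
    next
      case (2 x)
      obtain t n u where x: "x = ((t, n), u)" by (metis prod.exhaust)
      then have u: "u < t i" using 2 by auto
      from 2 x i show ?case
        using deg[of u t, OF u] by (auto simp: fiber_def wdeg_Suc wdeg_upd_same tuples_upd)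
    next
      case (1 x)
      obtain t n u where x: "x = ((t, n), u)" by (metis prod.exhaust)
      with 1 i show ?case
        by (auto simp: fiber_def fun_eq_iff tuples_upd)
    next
      case (3 x)
      then show ?case using i
        by (auto simp: fun_eq_iff)
    next
      case (5 x)
      obtain t n u where x: "x = ((t, n), u)" by (metis prod.exhaust)
      then have u: "u < t i" using 5 by auto
      from x i show ?case
        using val[of u t, OF u] by (auto simp: wval_Suc wval_upd_same)
    qed
    also have "\<dots> = (fps_const (c i) * fps_X ^ e i * wseries (Suc k) ?c ?e q g) $ N"
      by (simp only: wseries_monom_nth)
    finally show "wseries k c e q ?f $ N = (fps_const (c i) * fps_X ^ e i * wseries (Suc k) ?c ?e q g) $ N" .
  qed
  with g e i show "rational_fps (wseries k c e q ?f)"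
    by (simp add: rational_sums_def rational_fps_mult_monom less_Suc_eq)
qed


section \<open>Graded trees\<close>

text \<open>A certificate for depths: a pair \<open>r\<close>, \<open>\<delta>\<close> of this kind
  determines \<open>root_of\<close> and \<open>depth\<close>. It is easy to produce for attachments,
  products and skeletons, where a proof of \<open>rooted_tree\<close> would also have to treat
  uniqueness of parents.\<close>

definition graded :: "'a rtree \<Rightarrow> 'a \<Rightarrow> ('a \<Rightarrow> nat) \<Rightarrow> bool" where
  "graded T r \<delta> \<longleftrightarrow> r \<in> nodes T \<and> \<delta> r = 0 \<and>
    (\<forall>u v. (u, v) \<in> edges T \<longrightarrow> u \<in> nodes T \<and> v \<in> nodes T \<and> \<delta> v = Suc (\<delta> u)) \<and>
    (\<forall>v\<in>nodes T. v \<noteq> r \<longrightarrow> (\<exists>u. (u, v) \<in> edges T))"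

definition level :: "'a rtree \<Rightarrow> nat \<Rightarrow> 'a set" where
  "level T n = {v \<in> nodes T. depth T v = n}"

definition locally_finite :: "'a rtree \<Rightarrow> bool" where
  "locally_finite T \<longleftrightarrow> (\<forall>n. finite (level T n))"

definition graded_finite :: "'a rtree \<Rightarrow> bool" where
  "graded_finite T \<longleftrightarrow> (\<exists>r \<delta>. graded T r \<delta>) \<and> locally_finite T"

lemma gradedD:
  assumes "graded T r \<delta>"
  shows "r \<in> nodes T" "\<delta> r = 0" "(u, v) \<in> edges T \<Longrightarrow> u \<in> nodes T"
    "(u, v) \<in> edges T \<Longrightarrow> v \<in> nodes T" "(u, v) \<in> edges T \<Longrightarrow> \<delta> v = Suc (\<delta> u)"
    "v \<in> nodes T \<Longrightarrow> v \<noteq> r \<Longrightarrow> \<exists>u. (u, v) \<in> edges T"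
  using assms unfolding graded_def by blast+

lemma graded_root:
  assumes "graded T r \<delta>"
  shows "root_of T = r"
  unfolding root_of_def
proof (rule the_equality)
  show "r \<in> nodes T \<and> (\<forall>u. (u, r) \<notin> edges T)"
    using gradedD[OF assms] by force
qed (use gradedD[OF assms] in blast)

lemma graded_relpow:
  assumes "graded T r \<delta>" "(u, v) \<in> edges T ^^ n"
  shows "\<delta> v = \<delta> u + n"
  using assms(2) by (induction n arbitrary: v) (use gradedD(5)[OF assms(1)] in fastforce)+

lemma graded_reach:
  assumes "graded T r \<delta>" "v \<in> nodes T"
  shows "(r, v) \<in> edges T ^^ \<delta> v"
  using assms(2)
proof (induction "\<delta> v" arbitrary: v)
  case 0
  then have "v = r" using gradedD(5,6)[OF assms(1)] by (metis old.nat.distinct(1))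
  with 0 show ?case by simp
next
  case (Suc n)
  then have "v \<noteq> r" using gradedD(2)[OF assms(1)] by auto
  then obtain u where u: "(u, v) \<in> edges T"
    using gradedD(6)[OF assms(1) Suc.prems] by blast
  have *: "\<delta> v = Suc (\<delta> u)" "u \<in> nodes T"
    using gradedD(3,5)[OF assms(1)] u by blast+
  with Suc have "(r, u) \<in> edges T ^^ n"
    by fastforce
  with u Suc(2) show ?case by (metis relpow_Suc_I)
qed

text \<open>All paths from \<open>r\<close> to \<open>v\<close> have length
  \<open>\<delta> v\<close> (\<open>graded_relpow\<close>) and one exists
  (\<open>graded_reach\<close>), so the minimum in \<open>depth\<close> is explicit.\<close>

lemma graded_depth:
  assumes "graded T r \<delta>" "v \<in> nodes T"
  shows "depth T v = \<delta> v"
  unfolding depth_def graded_root[OF assms(1)]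
proof (rule Least_equality)
  show "(r, v) \<in> edges T ^^ \<delta> v" by (rule graded_reach[OF assms])
  show "\<delta> v \<le> n" if "(r, v) \<in> edges T ^^ n" for n
    using graded_relpow[OF assms(1) that] gradedD(2)[OF assms(1)] by simp
qed

lemma graded_level:
  assumes "graded T r \<delta>"
  shows "level T n = {v \<in> nodes T. \<delta> v = n}"
  using graded_depth[OF assms] by (auto simp: level_def)

text \<open>Unique parents allow a path to be traced back from its lower end, so all paths from the
  root to a node have the same length; \<open>depth\<close> is this length and grows by one along
  edges.\<close>

lemma rooted_tree_graded:
  assumes T: "rooted_tree T" and "nodes T \<noteq> {}"
  shows "graded T (root_of T) (depth T)"
proof -
  obtain r where r: "r \<in> nodes T" "\<And>u. (u, r) \<notin> edges T"
      "\<And>v. v \<in> nodes T - {r} \<Longrightarrow> \<exists>!u. (u, v) \<in> edges T" "\<And>v. v \<in> nodes T \<Longrightarrow> (r, v) \<in> (edges T)\<^sup>*"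
    and sub: "edges T \<subseteq> nodes T \<times> nodes T"
    using assms unfolding rooted_tree_def by metis
  have root: "root_of T = r"
    unfolding root_of_def by (rule the_equality) (use r in blast)+
  have unique: "n = n'" if "(r, v) \<in> edges T ^^ n" "(r, v) \<in> edges T ^^ n'" for n n' v
    using that
  proof (induction n arbitrary: v n')
    case 0
    then show ?case using r(2) by (cases n') auto
  next
    case (Suc n)
    then obtain u where u: "(r, u) \<in> edges T ^^ n" "(u, v) \<in> edges T" by auto
    with r(2) have "v \<noteq> r" by blast
    with Suc.prems(2) obtain n'' u' where n': "n' = Suc n''" "(r, u') \<in> edges T ^^ n''" "(u', v) \<in> edges T"
      by (cases n') auto
    have "u' = u"
      using r(3)[of v] u(2) n'(3) \<open>v \<noteq> r\<close> sub by blast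
    with Suc.IH[OF u(1)] n' show ?case by simp
  qed
  have depth: "depth T v = n" if "(r, v) \<in> edges T ^^ n" for v n
    unfolding depth_def root using that unique
    by (metis (mono_tags, lifting) LeastI)
  show ?thesis
    unfolding graded_def root
  proof (intro conjI allI ballI impI, goal_cases)
    case (5 u v)
    then obtain n where "(r, u) \<in> edges T ^^ n"
      using r(4)[of u] sub rtrancl_imp_relpow by blast
    with 5 show ?case
      using depth[of u n] depth[of v "Suc n"] by auto
  next
    case (6 v)
    with r(3)[of v] show ?case by blast
  qed (use r sub depth[of r 0] in auto)
qed

text \<open>The grading is pulled back along \<open>f\<close>. The comparison \<open>e\<close>
  concerns only edges between nodes, and \<open>sub\<close> says that all edges of \<open>T\<close>
  are of this kind.\<close>

lemma graded_iso:
  assumes U: "graded U r \<delta>" and f: "bij_betw f (nodes T) (nodes U)"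
    and sub: "edges T \<subseteq> nodes T \<times> nodes T"
    and e: "\<And>v w. v \<in> nodes T \<Longrightarrow> w \<in> nodes T \<Longrightarrow> (v, w) \<in> edges T \<longleftrightarrow> (f v, f w) \<in> edges U"
  shows "graded T (inv_into (nodes T) f r) (\<lambda>v. \<delta> (f v))"
proof -
  let ?r = "inv_into (nodes T) f r"
  have im: "f ` nodes T = nodes U"
    using f by (simp add: bij_betw_def)
  then have r: "?r \<in> nodes T" "f ?r = r"
    using gradedD(1)[OF U] by (auto intro: inv_into_into f_inv_into_f)
  have "\<exists>u. (u, v) \<in> edges T" if v: "v \<in> nodes T" "v \<noteq> ?r" for v
  proof -
    have "f v \<noteq> r"
      using v f by (metis bij_betw_inv_into_left)
    then obtain u' where u': "(u', f v) \<in> edges U"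
      using gradedD(6)[OF U] im v by blast
    then obtain u where "u \<in> nodes T" "u' = f u"
      using gradedD(3)[OF U] im by blast
    with u' e v show ?thesis by blast
  qed
  moreover have "u \<in> nodes T \<and> v \<in> nodes T \<and> \<delta> (f v) = Suc (\<delta> (f u))" if "(u, v) \<in> edges T" for u v
    using sub that e[of u v] gradedD(5)[OF U, of "f u" "f v"] by auto
  ultimately show ?thesis
    unfolding graded_def using r gradedD(2)[OF U] by simp
qed

text \<open>An isomorphism speaks only about edges; the pulled back grading shows that it preserves
  depths. The grading of \<open>U\<close> is asked for only when \<open>U\<close> is non-empty,
  because an empty tree has no root.\<close>

lemma card_level_iso:
  assumes T: "rooted_tree T" and iso: "tree_iso T U"
    and U: "nodes U \<noteq> {} \<Longrightarrow> graded U r \<delta>"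
  shows "card (level T n) = card (level U n)" "finite (level T n) \<longleftrightarrow> finite (level U n)"
proof -
  obtain f where f: "bij_betw f (nodes T) (nodes U)"
    and e: "\<And>v w. v \<in> nodes T \<Longrightarrow> w \<in> nodes T \<Longrightarrow> (v, w) \<in> edges T \<longleftrightarrow> (f v, f w) \<in> edges U"
    using iso unfolding tree_iso_def by blast
  have sub: "edges T \<subseteq> nodes T \<times> nodes T"
    using T by (auto simp: rooted_tree_def)
  have "bij_betw f (level T n) (level U n)"
  proof (cases "nodes U = {}")
    case True
    with f show ?thesis by (auto simp: level_def bij_betw_def)
  next
    case False
    note U = U[OF False]
    have T: "graded T (inv_into (nodes T) f r) (\<lambda>v. \<delta> (f v))"
      by (rule graded_iso[OF U f sub]) (rule e)
    show ?thesis
      unfolding graded_level[OF T] graded_level[OF U]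
      using f by (auto simp: bij_betw_def inj_on_def)
  qed
  then show "card (level T n) = card (level U n)" "finite (level T n) \<longleftrightarrow> finite (level U n)"
    by (auto simp: bij_betw_same_card bij_betw_finite)
qed

text \<open>Depths add: a node \<open>x\<close> of \<open>B v\<close> lies
  \<open>\<beta> v x\<close> below \<open>v\<close>. On the identified root this agrees with
  \<open>\<delta> v\<close>, as \<open>\<beta> v\<close> vanishes there.\<close>

lemma attach_graded:
  assumes T: "graded T r \<delta>" and A: "A \<subseteq> nodes T" and B: "\<And>v. v \<in> A \<Longrightarrow> graded (B v) (\<rho> v) (\<beta> v)"
  shows "graded (attach T A B) (Inl r) (case_sum \<delta> (\<lambda>(v, x). \<delta> v + \<beta> v x))"
proof -
  define emb where "emb = (\<lambda>v x. if x = root_of (B v) then Inl v else Inr (v, x))"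
  have nodes: "nodes (attach T A B) = Inl ` nodes T \<union> {emb v x | v x. v \<in> A \<and> x \<in> nodes (B v)}"
    by (simp add: attach_def emb_def)
  have edges: "edges (attach T A B) = {(Inl v, Inl w) | v w. (v, w) \<in> edges T} \<union>
      {(emb v x, emb v y) | v x y. v \<in> A \<and> (x, y) \<in> edges (B v)}"
    by (simp add: attach_def emb_def)
  let ?d = "case_sum \<delta> (\<lambda>(v, x). \<delta> v + \<beta> v x)"
  have d: "?d (emb v x) = \<delta> v + \<beta> v x" if "v \<in> A" for v x
    using gradedD(2)[OF B[OF that]] graded_root[OF B[OF that]] by (simp add: emb_def)
  have root: "emb v (\<rho> v) = Inl v" if "v \<in> A" for v
    using graded_root[OF B[OF that]] by (simp add: emb_def)
  show ?thesis
    unfolding graded_def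
  proof (intro conjI allI ballI impI)
    fix u v assume "(u, v) \<in> edges (attach T A B)"
    then consider x y where "u = Inl x" "v = Inl y" "(x, y) \<in> edges T"
      | w x y where "u = emb w x" "v = emb w y" "w \<in> A" "(x, y) \<in> edges (B w)"
      unfolding edges by blast
    then have "u \<in> nodes (attach T A B) \<and> v \<in> nodes (attach T A B) \<and> ?d v = Suc (?d u)"
    proof cases
      case 1
      with gradedD(3-5)[OF T] show ?thesis unfolding nodes by auto
    next
      case 2
      then have "x \<in> nodes (B w)" "y \<in> nodes (B w)" "\<beta> w y = Suc (\<beta> w x)"
        using gradedD(3-5)[OF B[OF 2(3)]] by blast+
      moreover from this have "u \<in> nodes (attach T A B)" "v \<in> nodes (attach T A B)"
        unfolding nodes using 2 by blast+
      ultimately show ?thesis using d[OF 2(3)] 2 by simp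
    qed
    then show "u \<in> nodes (attach T A B)" "v \<in> nodes (attach T A B)" "?d v = Suc (?d u)"
      by blast+
  next
    fix v assume "v \<in> nodes (attach T A B)" "v \<noteq> Inl r"
    \<comment> \<open>An identified root \<open>emb w (\<rho> w)\<close> is booked as the node
      \<open>w\<close> of \<open>T\<close>, so that in the second case a parent exists inside
      \<open>B w\<close>.\<close>
    then consider w where "v = Inl w" "w \<in> nodes T" "w \<noteq> r"
      | w x where "v = emb w x" "w \<in> A" "x \<in> nodes (B w)" "x \<noteq> \<rho> w"
    proof -
      assume nonroot: "v \<noteq> Inl r" and
        inl: "\<And>w. v = Inl w \<Longrightarrow> w \<in> nodes T \<Longrightarrow> w \<noteq> r \<Longrightarrow> thesis" and
        emb: "\<And>w x. v = emb w x \<Longrightarrow> w \<in> A \<Longrightarrow> x \<in> nodes (B w) \<Longrightarrow> x \<noteq> \<rho> w \<Longrightarrow> thesis"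
      assume "v \<in> nodes (attach T A B)"
      then consider w where "v = Inl w" "w \<in> nodes T" | w x where "v = emb w x" "w \<in> A" "x \<in> nodes (B w)"
        unfolding nodes by blast
      then show thesis
      proof cases
        case 1
        with inl nonroot show thesis by blast
      next
        case 2
        show thesis
        proof (cases "x = \<rho> w")
          case True
          with 2 root A inl nonroot show thesis by auto
        qed (use 2 emb in blast)
      qed
    qed
    then show "\<exists>u. (u, v) \<in> edges (attach T A B)"
    proof cases
      case 1
      then obtain u where "(u, w) \<in> edges T"
        using gradedD(6)[OF T] by blast
      with 1 have "(Inl u, v) \<in> edges (attach T A B)"
        unfolding edges by blast
      then show ?thesis ..
    next
      case 2
      then obtain y where "(y, x) \<in> edges (B w)"
        using gradedD(6)[OF B[OF 2(2)] 2(3,4)] by blast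
      with 2 have "(emb w y, v) \<in> edges (attach T A B)"
        unfolding edges by blast
      then show ?thesis ..
    qed
  qed (use gradedD(1,2)[OF T] in \<open>auto simp: nodes\<close>)
qed

text \<open>The root of \<open>B v\<close> is \<open>v\<close> itself, so a node in \<open>A\<close>
  is counted through its attached tree; only the nodes outside \<open>A\<close> need a separate
  term.\<close>

lemma level_attach:
  assumes T: "graded T r \<delta>" and A: "A \<subseteq> nodes T" and B: "\<And>v. v \<in> A \<Longrightarrow> graded (B v) (\<rho> v) (\<beta> v)"
    and fin: "\<And>v. v \<in> A \<Longrightarrow> locally_finite (B v)" and fin_T: "locally_finite T"
  shows "card (level (attach T A B) n) = card {v \<in> nodes T - A. \<delta> v = n} +
      (\<Sum>v | v \<in> A \<and> \<delta> v \<le> n. card (level (B v) (n - \<delta> v)))"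
    and "finite (level (attach T A B) n)"
proof -
  have finT: "finite {v \<in> nodes T. \<delta> v = i}" for i
    using fin_T unfolding locally_finite_def graded_level[OF T] by simp
  have "{v \<in> nodes T. \<delta> v \<le> n} = (\<Union>i\<le>n. {v \<in> nodes T. \<delta> v = i})"
    by auto
  with finT have finle: "finite {v \<in> nodes T. \<delta> v \<le> n}"
    by simp
  define emb where "emb = (\<lambda>(v, x). if x = \<rho> v then Inl v else Inr (v, x))"
  define X where "X = {v \<in> nodes T - A. \<delta> v = n}"
  define Y where "Y = (SIGMA v:{v \<in> A. \<delta> v \<le> n}. level (B v) (n - \<delta> v))"
  have root: "root_of (B v) = \<rho> v" if "v \<in> A" for v
    using graded_root[OF B[OF that]] .
  have nodes: "nodes (attach T A B) = Inl ` nodes T \<union> {emb (v, x) | v x. v \<in> A \<and> x \<in> nodes (B v)}"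
    unfolding attach_def emb_def Let_def rtree.sel using root by (intro arg_cong2[where f = "(\<union>)"]) (auto, metis+)
  have d: "case_sum \<delta> (\<lambda>(v, x). \<delta> v + \<beta> v x) (emb (v, x)) = \<delta> v + \<beta> v x" if "v \<in> A" for v x
    using gradedD(2)[OF B[OF that]] by (simp add: emb_def)
  have Y: "Y = {(v, x). v \<in> A \<and> x \<in> nodes (B v) \<and> \<delta> v + \<beta> v x = n}"
    using graded_level[OF B] by (auto simp: Y_def)
  have graded: "graded (attach T A B) (Inl r) (case_sum \<delta> (\<lambda>(v, x). \<delta> v + \<beta> v x))"
    by (rule attach_graded[OF T A]) (rule B)
  have "level (attach T A B) n = Inl ` X \<union> emb ` Y"
    unfolding graded_level[OF graded]
  proof (intro equalityI subsetI)
    fix z assume z: "z \<in> {v \<in> nodes (attach T A B). case_sum \<delta> (\<lambda>(v, x). \<delta> v + \<beta> v x) v = n}"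
    then consider v where "z = Inl v" "v \<in> nodes T - A" | v where "z = Inl v" "v \<in> A"
      | v x where "z = emb (v, x)" "v \<in> A" "x \<in> nodes (B v)"
      unfolding nodes by blast
    then show "z \<in> Inl ` X \<union> emb ` Y"
    proof cases
      case 1
      with z show ?thesis by (auto simp: X_def)
    next
      case 2
      then have "z = emb (v, \<rho> v)" "(v, \<rho> v) \<in> Y"
        using gradedD(1,2)[OF B] z by (auto simp: emb_def Y)
      then show ?thesis by blast
    next
      case 3
      with z d have "(v, x) \<in> Y" by (auto simp: Y)
      with 3 show ?thesis by blast
    qed
  next
    fix z assume "z \<in> Inl ` X \<union> emb ` Y"
    then show "z \<in> {v \<in> nodes (attach T A B). case_sum \<delta> (\<lambda>(v, x). \<delta> v + \<beta> v x) v = n}"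
      unfolding nodes using d by (auto simp: X_def Y)
  qed
  moreover have "Inl ` X \<inter> emb ` Y = {}"
    by (auto simp: X_def Y_def emb_def split: if_splits)
  moreover have "inj_on emb Y"
    by (auto simp: inj_on_def emb_def split: if_splits)
  moreover have "finite X"
    unfolding X_def by (rule finite_subset[OF _ finT[of n]]) auto
  moreover have finA: "finite {v \<in> A. \<delta> v \<le> n}"
    by (rule finite_subset[OF _ finle]) (use A in auto)
  moreover have "finite Y" "card Y = (\<Sum>v | v \<in> A \<and> \<delta> v \<le> n. card (level (B v) (n - \<delta> v)))"
    unfolding Y_def using finA fin by (auto simp: locally_finite_def)
  ultimately show "finite (level (attach T A B) n)"
      "card (level (attach T A B) n) = card {v \<in> nodes T - A. \<delta> v = n} +
      (\<Sum>v | v \<in> A \<and> \<delta> v \<le> n. card (level (B v) (n - \<delta> v)))"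
    by (simp_all add: card_Un_disjoint card_image X_def)
qed

section \<open>The layerwise product with the tree \<open>Tzp p\<close>\<close>

lemma Tzp_graded: "graded (Tzp p) [] length"
proof -
  have "\<exists>u. (u, xs) \<in> edges (Tzp p)" if "set xs \<subseteq> {..<p}" "xs \<noteq> []" for xs
    using that by (cases xs rule: rev_cases) (auto simp: Tzp_def)
  then show ?thesis
    by (auto simp: graded_def Tzp_def)
qed

lemma prod_Tzp_graded:
  assumes T: "graded T r \<delta>"
  shows "graded (tree_prod (Tzp p) T) ([], r) (\<lambda>(xs, v). \<delta> v)"
proof -
  have depth: "depth (Tzp p) xs = length xs" if "set xs \<subseteq> {..<p}" for xs
    using graded_depth[OF Tzp_graded] that by (simp add: Tzp_def)
  have nodes: "nodes (tree_prod (Tzp p) T) = {(xs, v). set xs \<subseteq> {..<p} \<and> v \<in> nodes T \<and> length xs = \<delta> v}"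
    using graded_depth[OF T] depth by (auto simp: tree_prod_def) (auto simp: Tzp_def)
  have edges: "edges (tree_prod (Tzp p) T) =
      {((xs, v), (xs @ [a], w)) | xs v a w. set xs \<subseteq> {..<p} \<and> a < p \<and> (v, w) \<in> edges T \<and> length xs = \<delta> v}"
    using graded_depth[OF T gradedD(3)[OF T]] depth by (auto simp: tree_prod_def) (auto simp: Tzp_def)
  show ?thesis
    unfolding graded_def
  proof (intro conjI allI ballI impI, goal_cases)
    case (6 y)
    obtain xs v where y: "y = (xs, v)" by force
    with 6 have xs: "set xs \<subseteq> {..<p}" "v \<in> nodes T" "length xs = \<delta> v"
      by (auto simp: nodes)
    have "v \<noteq> r"
      using 6 y xs gradedD(2)[OF T] by auto
    then obtain u where u: "(u, v) \<in> edges T"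
      using gradedD(6)[OF T xs(2)] by blast
    with gradedD(5)[OF T] xs obtain xs' a where "xs = xs' @ [a]"
      by (cases xs rule: rev_cases) auto
    with xs u gradedD(5)[OF T u] have "((xs', u), y) \<in> edges (tree_prod (Tzp p) T)"
      by (auto simp: edges y)
    then show ?case by blast
  qed (use gradedD[OF T] in \<open>auto simp: nodes edges\<close>)
qed

text \<open>Layer \<open>n\<close> of the product is a full product of layers, and layer
  \<open>n\<close> of \<open>Tzp p\<close> consists of the \<open>p ^ n\<close> words of length
  \<open>n\<close>.\<close>

lemma level_prod_Tzp:
  assumes T: "graded T r \<delta>"
  shows "card (level (tree_prod (Tzp p) T) n) = p ^ n * card (level T n)"
    "finite (level T n) \<Longrightarrow> finite (level (tree_prod (Tzp p) T) n)"
proof -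
  have depth: "depth (Tzp p) xs = length xs" if "set xs \<subseteq> {..<p}" for xs
    using graded_depth[OF Tzp_graded] that by (simp add: Tzp_def)
  have "level (tree_prod (Tzp p) T) n = {xs. set xs \<subseteq> {..<p} \<and> length xs = n} \<times> level T n"
    unfolding graded_level[OF prod_Tzp_graded[OF T]] graded_level[OF T]
    using graded_depth[OF T] depth by (auto simp: tree_prod_def) (auto simp: Tzp_def)
  then show "card (level (tree_prod (Tzp p) T) n) = p ^ n * card (level T n)"
    "finite (level T n) \<Longrightarrow> finite (level (tree_prod (Tzp p) T) n)"
    by (simp_all add: card_cartesian_product card_lists_length_eq finite_lists_length_eq)
qed


section \<open>Skeletons and side branches\<close>

text \<open>
  An infinite bone gets the junk length \<open>0\<close>; its lower joint is a virtual leaf, so the depth of no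
  real joint depends on it.
\<close>

definition bone_length :: "bone_lengths \<Rightarrow> int list \<Rightarrow> nat \<times> nat \<Rightarrow> nat" where
  "bone_length l \<kappa> e = (case l e \<kappa> of Fin z \<Rightarrow> nat z | _ \<Rightarrow> 0)"

text \<open>For \<open>n = depth S w\<close> this adds up the bone lengths between the root and
  \<open>w\<close>. The recursion runs over the number of bones, as the tree is no datatype;
  \<open>THE\<close> picks the parent, which is unique in a rooted tree.\<close>

primrec path_length :: "nat rtree \<Rightarrow> (nat \<times> nat \<Rightarrow> nat) \<Rightarrow> nat \<Rightarrow> nat \<Rightarrow> nat" where
  "path_length S len 0 w = 0"
| "path_length S len (Suc n) w =
    (let u = (THE u. (u, w) \<in> edges S) in path_length S len n u + len (u, w))"

text \<open>Coincides with \<open>joint_depth\<close> at real joints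
  (\<open>joint_depth_real\<close>), but is visibly a sum of bone lengths and thus affine along
  affine maps.\<close>

definition joint_pos :: "nat rtree \<Rightarrow> bone_lengths \<Rightarrow> int list \<Rightarrow> nat \<Rightarrow> nat" where
  "joint_pos S l \<kappa> w = path_length S (bone_length l \<kappa>) (depth S w) w"

definition skel_pos :: "nat rtree \<Rightarrow> bone_lengths \<Rightarrow> int list \<Rightarrow> skel_node \<Rightarrow> nat" where
  "skel_pos S l \<kappa> v = (case v of Inl w \<Rightarrow> joint_pos S l \<kappa> w | Inr (e, i) \<Rightarrow> joint_pos S l \<kappa> (fst e) + i)"

lemma skel_pos_simps [simp]:
  "skel_pos S l \<kappa> (Inl w) = joint_pos S l \<kappa> w"
  "skel_pos S l \<kappa> (Inr (e, i)) = joint_pos S l \<kappa> (fst e) + i"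
  by (simp_all add: skel_pos_def)

section \<open>Level 0 data and the depths of nodes in their skeletons\<close>

lemma rooted_tree_unique_parent:
  assumes "rooted_tree S" "(u, w) \<in> edges S" "(u', w) \<in> edges S"
  shows "u = u'"
proof -
  have "w \<in> nodes S" using assms by (auto simp: rooted_tree_def)
  with assms show ?thesis unfolding rooted_tree_def by blast
qed

lemma rooted_tree_edge:
  assumes "rooted_tree S" "(u, w) \<in> edges S"
  shows "u \<in> nodes S" "w \<in> nodes S" "depth S w = Suc (depth S u)" "(THE u. (u, w) \<in> edges S) = u"
proof -
  show *: "u \<in> nodes S" "w \<in> nodes S"
    using assms by (auto simp: rooted_tree_def)
  then show "depth S w = Suc (depth S u)"
    using gradedD(5)[OF rooted_tree_graded[OF assms(1)] assms(2)] by auto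
  show "(THE u. (u, w) \<in> edges S) = u"
  proof (rule the_equality)
    show "(u, w) \<in> edges S" by (rule assms(2))
    show "u' = u" if "(u', w) \<in> edges S" for u'
      by (rule rooted_tree_unique_parent[OF assms(1) that assms(2)])
  qed
qed

lemma joint_pos_edge:
  assumes "rooted_tree S" "(u, w) \<in> edges S"
  shows "joint_pos S l \<kappa> w = joint_pos S l \<kappa> u + bone_length l \<kappa> (u, w)"
  using rooted_tree_edge[OF assms] by (simp add: joint_pos_def)

locale level0 =
  fixes m :: nat and M :: "int list set" and S :: "nat rtree" and l :: bone_lengths
  assumes datum: "level0_datum m M S l"
begin

lemma rooted: "rooted_tree S" and finite_nodes: "finite (nodes S)"
  using datum by (auto simp: level0_datum_def)

lemma finite_edges: "finite (edges S)"
  by (rule finite_subset[of _ "nodes S \<times> nodes S"]) (use rooted finite_nodes in \<open>auto simp: rooted_tree_def\<close>)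

text \<open>\<open>linear_on\<close> allows either the constant infinity or finite values
  throughout, so the two cases hold uniformly on \<open>M\<close>. Positivity makes the
  \<open>nat\<close> in \<open>bone_length\<close> lossless.\<close>

lemma edge_cases:
  assumes "e \<in> edges S"
  obtains (infinite) "\<And>\<kappa>. \<kappa> \<in> M \<Longrightarrow> l e \<kappa> = Pinf"
  | (finite) "\<And>\<kappa>. \<kappa> \<in> M \<Longrightarrow> l e \<kappa> = Fin (int (bone_length l \<kappa> e))" "\<And>\<kappa>. \<kappa> \<in> M \<Longrightarrow> 0 < bone_length l \<kappa> e"
proof (cases "\<forall>\<kappa>\<in>M. l e \<kappa> = Pinf")
  case False
  have "linear_on m M (l e)" and pos: "\<And>\<kappa>. \<kappa> \<in> M \<Longrightarrow> Fin 0 < l e \<kappa>"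
    using datum assms by (auto simp: level0_datum_def)
  with False have "\<exists>z. l e \<kappa> = Fin z" if "\<kappa> \<in> M" for \<kappa>
    using that unfolding linear_on_def by blast
  with pos have "l e \<kappa> = Fin (int (bone_length l \<kappa> e)) \<and> 0 < bone_length l \<kappa> e" if "\<kappa> \<in> M" for \<kappa>
    using that by (fastforce simp: bone_length_def)
  then show thesis using finite by blast
qed (use infinite in blast)

text \<open>\<open>w\<close> has a single incoming bone, and by \<open>edge_cases\<close> its length
  is infinite at all points of \<open>M\<close> or at none.\<close>

lemma virtual_iff:
  assumes "(u, w) \<in> edges S" "\<kappa> \<in> M"
  shows "virtual M S l w \<longleftrightarrow> l (u, w) \<kappa> = Pinf"
proof -
  have "virtual M S l w \<longleftrightarrow> infinite_bone M l (u, w)"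
    using assms(1) rooted_tree_unique_parent[OF rooted assms(1)] unfolding virtual_def
    by (metis prod.collapse snd_conv)
  also have "\<dots> \<longleftrightarrow> l (u, w) \<kappa> = Pinf"
    using assms by (cases rule: edge_cases[OF assms(1)]) (auto simp: infinite_bone_def)
  finally show ?thesis .
qed

text \<open>A virtual joint is a leaf, hence not the upper end of a bone.\<close>

lemma upper_joint_real:
  assumes "(u, w) \<in> edges S"
  shows "u \<in> real_joints M S l"
  using assms datum rooted_tree_edge(1)[OF rooted]
  by (fastforce simp: real_joints_def virtual_def level0_datum_def leaves_def)

lemma joint_pos_root:
  assumes "nodes S \<noteq> {}"
  shows "joint_pos S l \<kappa> (root_of S) = 0"
  using gradedD(2)[OF rooted_tree_graded[OF rooted assms]] by (simp add: joint_pos_def)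

lemma bone_node_pos:
  assumes "e \<in> edges S" "\<kappa> \<in> M"
  shows "skel_pos S l \<kappa> (bone_node l e \<kappa> i) = joint_pos S l \<kappa> (fst e) + i"
  using joint_pos_edge[OF rooted, of "fst e" "snd e" l \<kappa>] assms
  by (cases rule: edge_cases[OF assms(1)]) (auto simp: bone_node_def)

lemma nodes_skeleton:
  "nodes (skeleton M S l \<kappa>) = Inl ` real_joints M S l \<union>
     {Inr (e, i) | e i. e \<in> edges S \<and> 0 < i \<and> Fin (int i) < l e \<kappa>}"
  and edges_skeleton: "edges (skeleton M S l \<kappa>) =
    {(bone_node l e \<kappa> i, bone_node l e \<kappa> (Suc i)) | e i. e \<in> edges S \<and> Fin (int i) < l e \<kappa>}"
  by (simp_all add: skeleton_def)

lemma bone_node_in: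
  assumes e: "e \<in> edges S" and "\<kappa> \<in> M" "Fin (int i) \<le> l e \<kappa>"
  shows "bone_node l e \<kappa> i \<in> nodes (skeleton M S l \<kappa>)"
proof -
  obtain u w where uw: "e = (u, w)" by force
  have "w \<in> real_joints M S l" if "l e \<kappa> = Fin (int i)"
    using that assms virtual_iff[of u w \<kappa>] rooted_tree_edge[OF rooted, of u w]
    by (auto simp: uw real_joints_def)
  moreover have "u \<in> real_joints M S l"
    using upper_joint_real e uw by blast
  moreover have "Inr (e, i) \<in> nodes (skeleton M S l \<kappa>)" if "i \<noteq> 0" "l e \<kappa> \<noteq> Fin (int i)"
  proof -
    have "Fin (int i) < l e \<kappa>"
      using order_le_imp_less_or_eq[OF assms(3)] that(2) by auto
    with that(1) e show ?thesis
      unfolding nodes_skeleton by blast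
  qed
  moreover have "Inl x \<in> nodes (skeleton M S l \<kappa>)" if "x \<in> real_joints M S l" for x
    using that by (simp add: nodes_skeleton)
  ultimately show ?thesis
    by (cases "i = 0"; cases "l e \<kappa> = Fin (int i)") (simp_all add: bone_node_def uw)
qed

lemma skeleton_graded:
  assumes "\<kappa> \<in> M" "nodes S \<noteq> {}"
  shows "graded (skeleton M S l \<kappa>) (Inl (root_of S)) (skel_pos S l \<kappa>)"
  unfolding graded_def
proof (intro conjI allI ballI impI)
  note S = rooted_tree_graded[OF rooted assms(2)]
  show "Inl (root_of S) \<in> nodes (skeleton M S l \<kappa>)"
    using gradedD(1,2,5)[OF S] by (auto simp: nodes_skeleton real_joints_def virtual_def)
  show "skel_pos S l \<kappa> (Inl (root_of S)) = 0"
    by (simp add: joint_pos_root[OF assms(2)])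
next
  fix u v assume "(u, v) \<in> edges (skeleton M S l \<kappa>)"
  then obtain e i where ei: "u = bone_node l e \<kappa> i" "v = bone_node l e \<kappa> (Suc i)" "e \<in> edges S"
      "Fin (int i) < l e \<kappa>"
    unfolding edges_skeleton by blast
  then have "Fin (int (Suc i)) \<le> l e \<kappa>"
    by (cases "l e \<kappa>") auto
  with ei assms(1) show "u \<in> nodes (skeleton M S l \<kappa>)" "v \<in> nodes (skeleton M S l \<kappa>)"
      "skel_pos S l \<kappa> v = Suc (skel_pos S l \<kappa> u)"
    by (simp_all add: bone_node_in bone_node_pos)
next
  fix v assume v: "v \<in> nodes (skeleton M S l \<kappa>)" "v \<noteq> Inl (root_of S)"
  \<comment> \<open>With \<open>0 < i\<close> the upper joint is excluded; both inserted nodes and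
    real joints other than the root are of this form.\<close>
  have edge: "\<exists>u. (u, bone_node l e \<kappa> i) \<in> edges (skeleton M S l \<kappa>)"
    if "e \<in> edges S" "0 < i" "Fin (int i) \<le> l e \<kappa>" for e i
  proof -
    have "Fin (int (i - 1)) < l e \<kappa>" "i = Suc (i - 1)"
      using that by (cases "l e \<kappa>"; auto)+
    then have "(bone_node l e \<kappa> (i - 1), bone_node l e \<kappa> i) \<in> edges (skeleton M S l \<kappa>)"
      unfolding edges_skeleton mem_Collect_eq
      using that(1,2) by (intro exI[of _ e] exI[of _ "i - 1"]) simp
    then show ?thesis ..
  qed
  from v(1) show "\<exists>u. (u, v) \<in> edges (skeleton M S l \<kappa>)"
    unfolding nodes_skeleton
  proof (elim UnE imageE CollectE exE conjE)
    fix w assume w: "v = Inl w" "w \<in> real_joints M S l"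
    then obtain u where u: "(u, w) \<in> edges S"
      using gradedD(6)[OF rooted_tree_graded[OF rooted assms(2)]] v(2) by (auto simp: real_joints_def)
    have "l (u, w) \<kappa> \<noteq> Pinf"
      using w(2) virtual_iff[OF u assms(1)] by (simp add: real_joints_def)
    then have *: "l (u, w) \<kappa> = Fin (int (bone_length l \<kappa> (u, w)))" "0 < bone_length l \<kappa> (u, w)"
      using assms(1) by (cases rule: edge_cases[OF u]; simp)+
    with edge[OF u *(2)] show ?thesis
      by (simp add: bone_node_def w)
  next
    fix e i assume ei: "v = Inr (e, i)" "e \<in> edges S" "0 < i" "Fin (int i) < l e \<kappa>"
    then have "bone_node l e \<kappa> i = v"
      using less_imp_neq[OF ei(4)] by (auto simp: bone_node_def)
    with edge[OF ei(2,3) less_imp_le[OF ei(4)]] show ?thesis by simp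
  qed
qed

lemma nodes_S_if_skeleton: "nodes (skeleton M S l \<kappa>) \<noteq> {} \<Longrightarrow> nodes S \<noteq> {}"
  using rooted by (auto simp: nodes_skeleton real_joints_def rooted_tree_def)

text \<open>Position at most \<open>n\<close> forces \<open>i \<le> n\<close> for inserted nodes, so
  infinite bones also contribute finitely many nodes.\<close>

lemma skel_level_subset:
  "{v \<in> nodes (skeleton M S l \<kappa>). skel_pos S l \<kappa> v \<le> n} \<subseteq> Inl ` nodes S \<union> Inr ` (edges S \<times> {..n})"
  by (auto simp: nodes_skeleton real_joints_def)

lemma finite_skel_le: "finite {v \<in> nodes (skeleton M S l \<kappa>). skel_pos S l \<kappa> v \<le> n}"
  by (rule finite_subset[OF skel_level_subset]) (use finite_nodes finite_edges in auto)

lemma skeleton_locally_finite: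
  assumes "\<kappa> \<in> M"
  shows "locally_finite (skeleton M S l \<kappa>)"
  unfolding locally_finite_def
proof
  fix n
  show "finite (level (skeleton M S l \<kappa>) n)"
  proof (cases "nodes (skeleton M S l \<kappa>) = {}")
    case False
    show ?thesis
      unfolding graded_level[OF skeleton_graded[OF assms nodes_S_if_skeleton[OF False]]]
      by (rule finite_subset[OF _ finite_skel_le[of \<kappa> n]]) auto
  qed (simp add: level_def)
qed

text \<open>Node count in depth \<open>n\<close> of a tree with something attached to every skeleton
  node. \<open>hb\<close> receives the depth twice: as an integer, which selects the residue class,
  and as last coordinate of the parameter.\<close>

definition skel_sum ::
    "(nat \<Rightarrow> int list \<Rightarrow> nat \<Rightarrow> rat) \<Rightarrow> (nat \<times> nat \<Rightarrow> int \<Rightarrow> int list \<Rightarrow> nat \<Rightarrow> rat) \<Rightarrow> int list \<Rightarrow> nat \<Rightarrow> rat" where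
  "skel_sum hj hb \<kappa> n =
    (\<Sum>w\<in>real_joints M S l. if joint_pos S l \<kappa> w \<le> n then hj w \<kappa> (n - joint_pos S l \<kappa> w) else 0) +
    (\<Sum>e\<in>edges S. \<Sum>i | 0 < i \<and> Fin (int i) < l e \<kappa> \<and> joint_pos S l \<kappa> (fst e) + i \<le> n.
       hb e (int (joint_pos S l \<kappa> (fst e) + i)) (\<kappa> @ [int (joint_pos S l \<kappa> (fst e) + i)])
         (n - (joint_pos S l \<kappa> (fst e) + i)))"

lemma sum_skeleton:
  fixes f :: "skel_node \<Rightarrow> rat"
  shows "(\<Sum>v | v \<in> nodes (skeleton M S l \<kappa>) \<and> skel_pos S l \<kappa> v \<le> n. f v) =
    (\<Sum>w\<in>real_joints M S l. if joint_pos S l \<kappa> w \<le> n then f (Inl w) else 0) +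
    (\<Sum>e\<in>edges S. \<Sum>i | 0 < i \<and> Fin (int i) < l e \<kappa> \<and> joint_pos S l \<kappa> (fst e) + i \<le> n. f (Inr (e, i)))"
proof -
  let ?J = "{w \<in> real_joints M S l. joint_pos S l \<kappa> w \<le> n}"
  let ?I = "\<lambda>e. {i. 0 < i \<and> Fin (int i) < l e \<kappa> \<and> joint_pos S l \<kappa> (fst e) + i \<le> n}"
  have fin: "finite (real_joints M S l)" "finite (?I e)" for e
    using finite_nodes by (auto simp: real_joints_def intro: finite_subset[of _ "{..n}"])
  have "{v \<in> nodes (skeleton M S l \<kappa>). skel_pos S l \<kappa> v \<le> n} = Inl ` ?J \<union> Inr ` (SIGMA e:edges S. ?I e)"
    by (auto simp: nodes_skeleton)
  then have "(\<Sum>v | v \<in> nodes (skeleton M S l \<kappa>) \<and> skel_pos S l \<kappa> v \<le> n. f v) =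
      sum f (Inl ` ?J \<union> Inr ` (SIGMA e:edges S. ?I e))"
    by (simp only:)
  also have "\<dots> = sum f (Inl ` ?J) + sum f (Inr ` (SIGMA e:edges S. ?I e))"
    by (rule sum.union_disjoint) (use fin finite_edges in auto)
  also have "sum f (Inl ` ?J) = (\<Sum>w\<in>real_joints M S l. if joint_pos S l \<kappa> w \<le> n then f (Inl w) else 0)"
    using fin(1) by (simp add: sum.reindex sum.inter_filter[symmetric])
  also have "sum f (Inr ` (SIGMA e:edges S. ?I e)) = (\<Sum>e\<in>edges S. \<Sum>i\<in>?I e. f (Inr (e, i)))"
    using fin(2) finite_edges by (simp add: sum.reindex sum.Sigma)
  finally show ?thesis .
qed

text \<open>The skeleton itself is treated as having one-point trees attached: a node contributes
  only in its own depth. So level 0 runs through the same sums as the higher levels.\<close>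

lemma card_level_skeleton:
  assumes "\<kappa> \<in> M"
  shows "rat_of_nat (card (level (skeleton M S l \<kappa>) n)) =
    skel_sum (\<lambda>_ _ n. if n = 0 then 1 else 0) (\<lambda>_ _ _ n. if n = 0 then 1 else 0) \<kappa> n"
proof -
  have "rat_of_nat (card (level (skeleton M S l \<kappa>) n)) =
      (\<Sum>v\<in>{v \<in> nodes (skeleton M S l \<kappa>). skel_pos S l \<kappa> v = n}. 1)"
  proof (cases "nodes (skeleton M S l \<kappa>) = {}")
    case False
    show ?thesis
      unfolding graded_level[OF skeleton_graded[OF assms nodes_S_if_skeleton[OF False]]] by simp
  qed (simp add: level_def)
  \<comment> \<open>Depths are at most \<open>n\<close> in this sum, so the truncated difference is
    \<open>0\<close> only for depth \<open>n\<close>.\<close>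
  also have "\<dots> = (\<Sum>v | v \<in> nodes (skeleton M S l \<kappa>) \<and> skel_pos S l \<kappa> v \<le> n.
      if n - skel_pos S l \<kappa> v = 0 then 1 else 0)"
    by (rule sum.mono_neutral_cong_left[OF finite_skel_le]) auto
  finally show ?thesis
    by (simp add: sum_skeleton skel_sum_def cong: if_cong)
qed

text \<open>An instance of \<open>level_attach\<close> with attachments at all nodes of the
  skeleton, so that its term for nodes outside \<open>A\<close> is zero.\<close>

lemma datum_tree_level:
  assumes \<kappa>: "\<kappa> \<in> M" and ne: "nodes (skeleton M S l \<kappa>) \<noteq> {}"
    and Bj: "\<forall>w\<in>real_joints M S l. graded_finite (side_branch p (Bj w) \<kappa>)"
    and Bb: "\<forall>e\<in>edges S. \<forall>i>0. Fin (int i) < l e \<kappa> \<longrightarrow>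
      (let \<mu> = int (joint_pos S l \<kappa> (fst e) + i)
       in graded_finite (side_branch p (Bb e (mod_rel \<rho> `` {\<mu>})) (\<kappa> @ [\<mu>])))"
  shows "\<exists>r \<delta>. graded (datum_tree p \<rho> M S l Bj Bb \<kappa>) r \<delta>"
    and "finite (level (datum_tree p \<rho> M S l Bj Bb \<kappa>) n)"
    and "rat_of_nat (card (level (datum_tree p \<rho> M S l Bj Bb \<kappa>) n)) =
      skel_sum (\<lambda>w \<kappa> n. of_nat (card (level (side_branch p (Bj w) \<kappa>) n)))
        (\<lambda>e \<mu> \<kappa> n. of_nat (card (level (side_branch p (Bb e (mod_rel \<rho> `` {\<mu>})) \<kappa>) n))) \<kappa> n"
proof -
  let ?T0 = "skeleton M S l \<kappa>"
  define B where "B = (\<lambda>v. case v of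
              Inl w \<Rightarrow> side_branch p (Bj w) \<kappa>
            | Inr (e, i) \<Rightarrow>
                let \<mu> = int (depth ?T0 v) in side_branch p (Bb e (mod_rel \<rho> `` {\<mu>})) (\<kappa> @ [\<mu>]))"
  have tree: "datum_tree p \<rho> M S l Bj Bb \<kappa> = attach ?T0 (nodes ?T0) B"
    by (simp add: datum_tree_def B_def Let_def)
  note T0 = skeleton_graded[OF \<kappa> nodes_S_if_skeleton[OF ne]]
  have Inl: "B (Inl w) = side_branch p (Bj w) \<kappa>" for w
    by (simp add: B_def)
  \<comment> \<open>Replaces the \<open>depth\<close> in \<open>datum_tree\<close> by the explicit
    position on the bone.\<close>
  have Inr: "B (Inr (e, i)) = side_branch p (Bb e (mod_rel \<rho> `` {int (joint_pos S l \<kappa> (fst e) + i)}))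
      (\<kappa> @ [int (joint_pos S l \<kappa> (fst e) + i)])"
    if "e \<in> edges S" "0 < i" "Fin (int i) < l e \<kappa>" for e i
  proof -
    have "Inr (e, i) \<in> nodes ?T0"
      unfolding nodes_skeleton using that by blast
    from graded_depth[OF T0 this] show ?thesis
      by (simp add: B_def Let_def)
  qed
  have B: "graded_finite (B v)" if "v \<in> nodes ?T0" for v
    using that unfolding nodes_skeleton
  proof (elim UnE imageE CollectE exE conjE)
    fix w assume "v = Inl w" "w \<in> real_joints M S l"
    with Bj show ?thesis by (simp add: B_def)
  next
    fix e i assume "v = Inr (e, i)" "e \<in> edges S" "0 < i" "Fin (int i) < l e \<kappa>"
    with Bb show ?thesis by (simp add: Inr Let_def)
  qed
  then obtain \<sigma> \<beta> where \<beta>: "\<And>v. v \<in> nodes ?T0 \<Longrightarrow> graded (B v) (\<sigma> v) (\<beta> v)"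
    unfolding graded_finite_def by metis
  have B_finite: "locally_finite (B v)" if "v \<in> nodes ?T0" for v
    using B[OF that] by (simp add: graded_finite_def)
  show "\<exists>r \<delta>. graded (datum_tree p \<rho> M S l Bj Bb \<kappa>) r \<delta>"
    unfolding tree using attach_graded[OF T0 subset_refl] \<beta> by blast
  note lev = level_attach[where B = B and \<beta> = \<beta> and \<rho> = \<sigma>, OF T0 subset_refl \<beta> B_finite
      skeleton_locally_finite[OF \<kappa>], simplified]
  show "finite (level (datum_tree p \<rho> M S l Bj Bb \<kappa>) n)"
    unfolding tree by (rule lev)
  have "rat_of_nat (card (level (datum_tree p \<rho> M S l Bj Bb \<kappa>) n)) =
      (\<Sum>v | v \<in> nodes ?T0 \<and> skel_pos S l \<kappa> v \<le> n. of_nat (card (level (B v) (n - skel_pos S l \<kappa> v))))"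
    unfolding tree lev(1) by simp
  also have "\<dots> = skel_sum (\<lambda>w \<kappa> n. of_nat (card (level (side_branch p (Bj w) \<kappa>) n)))
        (\<lambda>e \<mu> \<kappa> n. of_nat (card (level (side_branch p (Bb e (mod_rel \<rho> `` {\<mu>})) \<kappa>) n))) \<kappa> n"
    unfolding sum_skeleton skel_sum_def
    by (intro arg_cong2[where f = "(+)"] sum.cong refl) (auto simp: Inl Inr)
  finally show "rat_of_nat (card (level (datum_tree p \<rho> M S l Bj Bb \<kappa>) n)) = \<dots>" .
qed

end

section \<open>Node counts of side branches\<close>

lemma side_branch_level:
  assumes F: "rooted_tree F" "finite (nodes F)" "nodes F \<noteq> {}"
    and T: "\<And>w. w \<in> leaves F \<Longrightarrow> rooted_tree (T w \<kappa>)" "\<And>w. w \<in> leaves F \<Longrightarrow> nodes (T w \<kappa>) \<noteq> {}"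
      "\<And>w. w \<in> leaves F \<Longrightarrow> locally_finite (T w \<kappa>)"
  shows "graded_finite (side_branch p (F, T) \<kappa>)"
    and "card (level (side_branch p (F, T) \<kappa>) n) = card {x \<in> nodes F - leaves F. depth F x = n} +
      (\<Sum>w\<in>leaves F. if depth F w \<le> n
         then p ^ (n - depth F w) * card (level (T w \<kappa>) (n - depth F w)) else 0)"
proof -
  let ?B = "\<lambda>w. tree_prod (Tzp p) (T w \<kappa>)"
  note F' = rooted_tree_graded[OF F(1,3)]
  have T': "graded (T w \<kappa>) (root_of (T w \<kappa>)) (depth (T w \<kappa>))" if "w \<in> leaves F" for w
    using T(1,2)[OF that] by (rule rooted_tree_graded)
  have sub: "leaves F \<subseteq> nodes F" by (auto simp: leaves_def)
  have tree: "side_branch p (F, T) \<kappa> = attach F (leaves F) ?B"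
    by (simp add: side_branch_def)
  have fin: "locally_finite (?B w)" if "w \<in> leaves F" for w
    using level_prod_Tzp(2)[OF T'[OF that]] T(3)[OF that] by (simp add: locally_finite_def)
  have finF: "locally_finite F"
    using F(2) by (simp add: locally_finite_def level_def)
  note lev = level_attach[where B = ?B, OF F' sub prod_Tzp_graded[OF T'] fin finF, simplified]
  have "\<exists>r \<delta>. graded (side_branch p (F, T) \<kappa>) r \<delta>"
    unfolding tree using attach_graded[where B = ?B, OF F' sub prod_Tzp_graded[OF T']] by blast
  with lev(2) show "graded_finite (side_branch p (F, T) \<kappa>)"
    by (simp add: graded_finite_def locally_finite_def tree)
  have "finite (leaves F)" using sub F(2) finite_subset by blast
  then have "(\<Sum>w | w \<in> leaves F \<and> depth F w \<le> n. card (level (?B w) (n - depth F w))) =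
    (\<Sum>w\<in>leaves F. if depth F w \<le> n
         then p ^ (n - depth F w) * card (level (T w \<kappa>) (n - depth F w)) else 0)"
    by (subst sum.inter_filter) (auto intro!: sum.cong level_prod_Tzp(1)[OF T'])
  with lev(1) show "card (level (side_branch p (F, T) \<kappa>) n) = card {x \<in> nodes F - leaves F. depth F x = n} +
      (\<Sum>w\<in>leaves F. if depth F w \<le> n
         then p ^ (n - depth F w) * card (level (T w \<kappa>) (n - depth F w)) else 0)"
    unfolding tree by simp
qed


section \<open>Affine substitutions\<close>

definition affine_fun :: "nat \<Rightarrow> ((nat \<Rightarrow> nat) \<Rightarrow> int) \<Rightarrow> bool" where
  "affine_fun k f \<longleftrightarrow> (\<exists>a b. \<forall>t. f t = b + (\<Sum>i<k. a i * int (t i)))"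

definition affine_map :: "nat \<Rightarrow> nat \<Rightarrow> ((nat \<Rightarrow> nat) \<Rightarrow> int list) \<Rightarrow> bool" where
  "affine_map k m \<phi> \<longleftrightarrow> (\<forall>t. length (\<phi> t) = m) \<and> (\<forall>j<m. affine_fun k (\<lambda>t. \<phi> t ! j))"

section \<open>Closure properties and integrality of affine functions\<close>

lemma affine_fun_const: "affine_fun k (\<lambda>t. c)"
  unfolding affine_fun_def by (rule exI[of _ "\<lambda>_. 0"], rule exI[of _ c]) simp

lemma affine_fun_var:
  assumes "i < k"
  shows "affine_fun k (\<lambda>t. int (t i))"
  unfolding affine_fun_def
  by (rule exI[of _ "\<lambda>j. if j = i then 1 else 0"], rule exI[of _ 0])
    (use assms in \<open>simp add: if_distrib[of "\<lambda>x. x * _"] cong: if_cong\<close>)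

lemma affine_fun_add:
  assumes "affine_fun k f" "affine_fun k g"
  shows "affine_fun k (\<lambda>t. f t + g t)"
proof -
  obtain a b a' b' where "\<And>t. f t = b + (\<Sum>i<k. a i * int (t i))" "\<And>t. g t = b' + (\<Sum>i<k. a' i * int (t i))"
    using assms unfolding affine_fun_def by metis
  then have "f t + g t = (b + b') + (\<Sum>i<k. (a i + a' i) * int (t i))" for t
    by (simp add: distrib_right sum.distrib)
  then show ?thesis unfolding affine_fun_def by metis
qed

lemma affine_fun_cmult:
  assumes "affine_fun k f"
  shows "affine_fun k (\<lambda>t. c * f t)"
proof -
  obtain a b where "\<And>t. f t = b + (\<Sum>i<k. a i * int (t i))"
    using assms unfolding affine_fun_def by metis
  then have "c * f t = c * b + (\<Sum>i<k. (c * a i) * int (t i))" for t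
    by (simp add: distrib_left sum_distrib_left mult.assoc)
  then show ?thesis unfolding affine_fun_def by metis
qed

lemma affine_fun_sum:
  assumes "finite A" "\<And>x. x \<in> A \<Longrightarrow> affine_fun k (f x)"
  shows "affine_fun k (\<lambda>t. \<Sum>x\<in>A. f x t)"
  using assms by (induction A rule: finite_induct) (auto intro: affine_fun_const affine_fun_add)

lemma affine_fun_subst:
  assumes "affine_fun k f" "\<And>i. i < k \<Longrightarrow> affine_fun k' (\<lambda>t. int (\<psi> t i))"
  shows "affine_fun k' (\<lambda>t. f (\<psi> t))"
proof -
  obtain a b where f: "\<And>t. f t = b + (\<Sum>i<k. a i * int (t i))"
    using assms unfolding affine_fun_def by metis
  show ?thesis
    unfolding f using assms(2)
    by (intro affine_fun_add affine_fun_const affine_fun_sum affine_fun_cmult) auto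
qed

lemma affine_fun_wdeg: "affine_fun k (\<lambda>t. int (b + wdeg k a t))"
  unfolding affine_fun_def wdeg_def
  by (rule exI[of _ "\<lambda>i. int (a i)"], rule exI[of _ "int b"]) simp

text \<open>A negative coefficient would make \<open>z\<close> negative far out on its axis, and
  comparing the values at a unit vector and at the origin modulo \<open>r\<close> shows that
  \<open>r\<close> divides each coefficient.\<close>

lemma affine_fun_nonneg:
  assumes z: "affine_fun k z" and nonneg: "\<And>t. 0 \<le> z t" and "0 < r"
    and mod: "\<And>t t'. z t mod int r = z t' mod int r"
  shows "\<exists>b a. \<forall>t. z t = int (b + r * wdeg k a t)"
proof -
  obtain a b where z: "\<And>t. z t = b + (\<Sum>i<k. a i * int (t i))"
    using z unfolding affine_fun_def by metis
  have b: "0 \<le> b" using nonneg[of "\<lambda>_. 0"] by (simp add: z)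
  have unit: "z (\<lambda>j. if j = i then x else 0) = b + a i * int x" if "i < k" for i x
    using that by (simp add: z if_distrib[of int] if_distrib[of "(*) _"] cong: if_cong)
  have a: "0 \<le> a i" "int r dvd a i" if "i < k" for i
  proof -
    show "0 \<le> a i"
    proof (rule ccontr)
      assume "\<not> 0 \<le> a i"
      \<comment> \<open>At \<open>t i = b + 1\<close>, with all other coordinates \<open>0\<close>,
        the value would be at most \<open>b - (b + 1) < 0\<close>.\<close>
      then have "a i * (b + 1) \<le> -1 * (b + 1)"
        using b by (intro mult_right_mono) auto
      moreover have "0 \<le> b + a i * (b + 1)"
        using nonneg[of "\<lambda>j. if j = i then nat (b + 1) else 0"] unfolding unit[OF that] using b by simp
      ultimately show False by simp
    qed
    show "int r dvd a i"
      using mod[of "\<lambda>j. if j = i then 1 else 0" "\<lambda>j. if j = i then 0 else 0"]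
      unfolding unit[OF that] by (simp add: mod_eq_dvd_iff)
  qed
  have "z t = int (nat b + r * wdeg k (\<lambda>i. nat (a i div int r)) t)" for t
  proof -
    have "(\<Sum>i<k. a i * int (t i)) = (\<Sum>i<k. int r * (int (nat (a i div int r)) * int (t i)))"
      using a \<open>0 < r\<close> by (intro sum.cong) (auto simp: pos_imp_zdiv_nonneg_iff)
    then show ?thesis
      using b by (simp add: z wdeg_def sum_distrib_left)
  qed
  then show ?thesis by blast
qed

lemma affine_fun_nat:
  assumes "affine_fun k (\<lambda>t. int (f t))"
  obtains b a where "\<And>t. f t = b + wdeg k a t"
  using affine_fun_nonneg[OF assms, of 1] by (auto simp del: of_nat_add)

text \<open>Slots from \<open>k\<close> on are ignored by \<open>\<phi>\<close>, which leaves slot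
  \<open>k\<close> free for the index along a bone.\<close>

lemma affine_map_cong:
  assumes "affine_map k m \<phi>" "\<And>i. i < k \<Longrightarrow> t i = t' i"
  shows "\<phi> t = \<phi> t'"
proof (rule nth_equalityI)
  fix j assume "j < length (\<phi> t)"
  then obtain a b where "\<And>t. \<phi> t ! j = b + (\<Sum>i<k. a i * int (t i))"
    using assms(1) unfolding affine_map_def affine_fun_def by metis
  with assms(2) show "\<phi> t ! j = \<phi> t' ! j" by simp
qed (use assms(1) in \<open>simp add: affine_map_def\<close>)

lemma affine_map_subst:
  assumes "affine_map k m \<phi>" "\<And>i. i < k \<Longrightarrow> affine_fun k' (\<lambda>t. int (\<psi> t i))"
  shows "affine_map k' m (\<lambda>t. \<phi> (\<psi> t))"
  using assms affine_fun_subst[of k "\<lambda>t. \<phi> t ! _" k' \<psi>] by (simp add: affine_map_def)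

lemma affine_map_snoc:
  assumes "affine_map k m \<phi>" "affine_fun k f"
  shows "affine_map k (Suc m) (\<lambda>t. \<phi> t @ [f t])"
  using assms by (auto simp: affine_map_def nth_append less_Suc_eq)

text \<open>The rational coefficients of a linear function become integral on a lattice cone inside its domain.\<close>

lemma linear_on_affine:
  assumes lin: "linear_on m M l" and \<phi>: "affine_map k m \<phi>" "\<And>t. \<phi> t \<in> M"
    and z: "\<And>t. l (\<phi> t) = Fin (z t)"
  shows "affine_fun k z"
proof -
  obtain a b where ab: "\<And>\<kappa>. \<kappa> \<in> M \<Longrightarrow> \<exists>z. l \<kappa> = Fin z \<and> rat_of_int z = (\<Sum>i<m. a i * of_int (\<kappa> ! i)) + b"
    using lin \<phi>(2) z unfolding linear_on_def by fastforce
  obtain \<alpha> \<beta> where \<phi>_eq: "\<And>t j. j < m \<Longrightarrow> \<phi> t ! j = \<beta> j + (\<Sum>i<k. \<alpha> j i * int (t i))"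
    using \<phi>(1) unfolding affine_map_def affine_fun_def by metis
  define B where "B = b + (\<Sum>j<m. a j * of_int (\<beta> j))"
  define A where "A i = (\<Sum>j<m. a j * of_int (\<alpha> j i))" for i
  have zA: "of_int (z t) = B + (\<Sum>i<k. A i * of_nat (t i))" for t
  proof -
    have "of_int (z t) = (\<Sum>j<m. a j * of_int (\<phi> t ! j)) + b"
      using ab[OF \<phi>(2)[of t]] z by auto
    also have "(\<Sum>j<m. a j * of_int (\<phi> t ! j)) =
        (\<Sum>j<m. a j * of_int (\<beta> j) + (\<Sum>i<k. a j * of_int (\<alpha> j i) * of_nat (t i)))"
      by (rule sum.cong) (auto simp: \<phi>_eq distrib_left sum_distrib_left mult.assoc)
    also have "\<dots> = (\<Sum>j<m. a j * of_int (\<beta> j)) + (\<Sum>i<k. A i * of_nat (t i))"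
      by (simp add: sum.distrib A_def sum_distrib_right sum.swap[of _ "{..<k}"])
    finally show ?thesis by (simp add: B_def)
  qed
  \<comment> \<open>Differences between the integer values of \<open>z\<close> at unit vectors and
    at the origin; they turn out to be the rational coefficients \<open>A i\<close>.\<close>
  define c where "c i = z (\<lambda>j. if j = i then 1 else 0) - z (\<lambda>_. 0)" for i
  have "A i = of_int (c i)" if "i < k" for i
    using that by (simp add: c_def zA if_distrib[of of_nat] if_distrib[of "(*) _"] cong: if_cong)
  moreover have "B = of_int (z (\<lambda>_. 0))"
    by (simp add: zA)
  ultimately have "rat_of_int (z t) = of_int (z (\<lambda>_. 0) + (\<Sum>i<k. c i * int (t i)))" for t
    by (simp add: zA[of t])
  then show ?thesis
    unfolding affine_fun_def of_int_eq_iff by metis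
qed


section \<open>Parametrized counts with rational sums\<close>

text \<open>The invariant of the induction on the level. For \<open>m = 0\<close> and
  \<open>M = {[]}\<close> it contains, with \<open>k = 0\<close> and \<open>q = 1\<close>, the
  rationality of the series with coefficients \<open>h [] n\<close>.\<close>

definition rational_counts :: "nat \<Rightarrow> int list set \<Rightarrow> (int list \<Rightarrow> nat \<Rightarrow> rat) \<Rightarrow> bool" where
  "rational_counts m M h \<longleftrightarrow>
    (\<forall>k \<phi>. affine_map k m \<phi> \<longrightarrow> (\<forall>t. \<phi> t \<in> M) \<longrightarrow> rational_sums k (\<lambda>t. h (\<phi> t)))"

lemma rational_countsD:
  "rational_counts m M h \<Longrightarrow> affine_map k m \<phi> \<Longrightarrow> (\<And>t. \<phi> t \<in> M) \<Longrightarrow> rational_sums k (\<lambda>t. h (\<phi> t))"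
  by (simp add: rational_counts_def)

lemma rational_counts_cong:
  assumes "\<And>\<kappa> n. \<kappa> \<in> M \<Longrightarrow> h \<kappa> n = h' \<kappa> n"
  shows "rational_counts m M h \<longleftrightarrow> rational_counts m M h'"
proof -
  have "(\<lambda>t. h (\<phi> t)) = (\<lambda>t. h' (\<phi> t))" if "\<forall>t. \<phi> t \<in> M" for \<phi> :: "(nat \<Rightarrow> nat) \<Rightarrow> int list"
    using that assms by (simp add: fun_eq_iff)
  then show ?thesis unfolding rational_counts_def by metis
qed

lemma rational_counts_delta: "rational_counts m M (\<lambda>\<kappa> n. if n = 0 then 1 else 0)"
  by (simp add: rational_counts_def rational_sums_delta)

lemma rational_counts_add:
  "rational_counts m M h \<Longrightarrow> rational_counts m M h' \<Longrightarrow> rational_counts m M (\<lambda>\<kappa> n. h \<kappa> n + h' \<kappa> n)"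
  by (simp add: rational_counts_def rational_sums_add)

lemma rational_counts_sum:
  "finite A \<Longrightarrow> (\<And>x. x \<in> A \<Longrightarrow> rational_counts m M (h x)) \<Longrightarrow>
    rational_counts m M (\<lambda>\<kappa> n. \<Sum>x\<in>A. h x \<kappa> n)"
  by (simp add: rational_counts_def rational_sums_sum)

lemma rational_counts_power:
  "rational_counts m M h \<Longrightarrow> rational_counts m M (\<lambda>\<kappa> n. r ^ n * h \<kappa> n)"
  by (simp add: rational_counts_def rational_sums_power)

lemma rational_counts_shift:
  assumes "rational_counts m M h"
  shows "rational_counts m M (\<lambda>\<kappa> n. if d \<le> n then h \<kappa> (n - d) else 0)"
  unfolding rational_counts_def
proof (intro allI impI)
  fix k \<phi> assume "affine_map k m \<phi>" "\<forall>t. \<phi> t \<in> M"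
  then have "rational_sums k (\<lambda>t. h (\<phi> t))"
    using rational_countsD[OF assms] by blast
  then show "rational_sums k (\<lambda>t n. if d \<le> n then h (\<phi> t) (n - d) else 0)"
    by (rule rational_sums_shift[where b = d and a = "\<lambda>_. 0"]) (simp add: wdeg_def)
qed

text \<open>
  The interval \<open>{..<L t}\<close> is cut into single points \<open>s = L' t\<close> and blocks \<open>L' t \<le> s < L' t + t\<^sub>i\<close>.
  On a block, \<open>t\<^sub>i = u + 1 + v\<close> with \<open>u = s - L' t\<close>, and the free variables \<open>u, v\<close> range over \<open>\<nat>\<close>.
\<close>

lemma rational_sums_bounded:
  assumes F: "\<And>k' \<psi> s. (\<And>i. i < k \<Longrightarrow> affine_fun k' (\<lambda>t. int (\<psi> t i))) \<Longrightarrow>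
      affine_fun k' (\<lambda>t. int (s t)) \<Longrightarrow> (\<And>t. s t < L (\<psi> t)) \<Longrightarrow> rational_sums k' (\<lambda>t. F (\<psi> t) (s t))"
    and L: "\<And>t. L t = b + wdeg k a t"
  shows "rational_sums k (\<lambda>t n. \<Sum>s<L t. F t s n)"
proof -
  \<comment> \<open>\<open>P\<close> is closed under adding \<open>1\<close> and under adding
    \<open>t i\<close>. The bound by \<open>L\<close> is a premise inside \<open>P\<close> because
    \<open>F\<close> is controlled only for indices below \<open>L\<close>.\<close>
  define P where "P L' \<longleftrightarrow> affine_fun k (\<lambda>t. int (L' t)) \<and>
    ((\<forall>t. L' t \<le> L t) \<longrightarrow> rational_sums k (\<lambda>t n. \<Sum>s<L' t. F t s n))" for L'
  have P_point: "P (\<lambda>t. Suc (L' t))" if "P L'" for L'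
  proof -
    have aff: "affine_fun k (\<lambda>t. int (L' t))" using that by (simp add: P_def)
    have "rational_sums k (\<lambda>t n. \<Sum>s<Suc (L' t). F t s n)" if le: "\<And>t. Suc (L' t) \<le> L t"
    proof -
      have "rational_sums k (\<lambda>t. F t (L' t))"
        by (rule F) (use aff le in \<open>auto intro: affine_fun_var simp: Suc_le_eq\<close>)
      moreover have "rational_sums k (\<lambda>t n. \<Sum>s<L' t. F t s n)"
        using \<open>P L'\<close> le Suc_leD by (auto simp: P_def)
      ultimately show ?thesis
        using rational_sums_add by fastforce
    qed
    moreover have "affine_fun k (\<lambda>t. int (Suc (L' t)))"
      using affine_fun_add[OF affine_fun_const[of k 1] aff] by simp
    ultimately show ?thesis by (simp add: P_def)
  qed
  have P_block: "P (\<lambda>t. L' t + t i)" if "P L'" "i < k" for L' i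
  proof -
    have aff: "affine_fun k (\<lambda>t. int (L' t))" using that by (simp add: P_def)
    have "rational_sums k (\<lambda>t n. \<Sum>s<L' t + t i. F t s n)" if le: "\<And>t. L' t + t i \<le> L t"
    proof -
      have split: "sum f {..<x} + (\<Sum>u<y. f (x + u)) = sum f {..<x + y}" for f :: "nat \<Rightarrow> rat" and x y
        by (induction y) simp_all
      \<comment> \<open>Inverts the substitution of \<open>rational_sums_block\<close>: slot
        \<open>i\<close> holds \<open>v\<close>, slot \<open>k\<close> holds
        \<open>u\<close>.\<close>
      define \<psi> where "\<psi> = (\<lambda>t :: nat \<Rightarrow> nat. t(k := 0, i := t i + Suc (t k)))"
      define g where "g = (\<lambda>t. F (\<psi> t) (L' (\<psi> t) + t k))"
      have aff_\<psi>: "affine_fun (Suc k) (\<lambda>t. int (\<psi> t j))" if "j < k" for j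
      proof (cases "j = i")
        case True
        have "affine_fun (Suc k) (\<lambda>t. int (t i) + (1 + int (t k)))"
          using \<open>i < k\<close> by (intro affine_fun_add affine_fun_var affine_fun_const) auto
        with True show ?thesis by (simp add: \<psi>_def algebra_simps)
      next
        case False
        with that affine_fun_var[of j "Suc k"] show ?thesis by (simp add: \<psi>_def)
      qed
      have "rational_sums (Suc k) g"
        unfolding g_def
      proof (rule F[OF aff_\<psi>])
        show "affine_fun (Suc k) (\<lambda>t. int (L' (\<psi> t) + t k))"
          using affine_fun_add[OF affine_fun_subst[OF aff aff_\<psi>] affine_fun_var[of k "Suc k"]] by simp
        show "L' (\<psi> t) + t k < L (\<psi> t)" for t
          using le[of "\<psi> t"] by (simp add: \<psi>_def)
      qed
      from rational_sums_block[OF this \<open>i < k\<close>]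
      have "rational_sums k (\<lambda>t n. \<Sum>u<t i. g (t(i := t i - Suc u, k := u)) n)" .
      also have "?this \<longleftrightarrow> rational_sums k (\<lambda>t n. \<Sum>u<t i. F t (L' t + u) n)"
      proof (rule rational_sums_cong, rule sum.cong)
        fix t :: "nat \<Rightarrow> nat" and n u assume t: "t \<in> tuples k" "u \<in> {..<t i}"
        then have "\<psi> (t(i := t i - Suc u, k := u)) = t"
          using \<open>i < k\<close> tuples_upd(4)[OF t(1)] by (auto simp: \<psi>_def fun_eq_iff)
        then show "g (t(i := t i - Suc u, k := u)) n = F t (L' t + u) n"
          by (simp add: g_def)
      qed simp
      finally have "rational_sums k (\<lambda>t n. \<Sum>u<t i. F t (L' t + u) n)" .
      moreover have "rational_sums k (\<lambda>t n. \<Sum>s<L' t. F t s n)"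
        using \<open>P L'\<close> add_leD1[OF le] by (simp add: P_def)
      ultimately have "rational_sums k (\<lambda>t n. (\<Sum>s<L' t. F t s n) + (\<Sum>u<t i. F t (L' t + u) n))"
        by (intro rational_sums_add)
      moreover have "(\<Sum>s<L' t. F t s n) + (\<Sum>u<t i. F t (L' t + u) n) = (\<Sum>s<L' t + t i. F t s n)" for t n
        by (rule split)
      ultimately show ?thesis by simp
    qed
    moreover have "affine_fun k (\<lambda>t. int (L' t + t i))"
      using affine_fun_add[OF aff affine_fun_var[OF \<open>i < k\<close>]] by simp
    ultimately show ?thesis by (simp add: P_def)
  qed
  \<comment> \<open>\<open>L\<close> is built from \<open>0\<close>: add \<open>1\<close> exactly
    \<open>b\<close> times, then \<open>t j\<close> exactly \<open>a j\<close> times for each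
    \<open>j < k\<close>.\<close>
  have "P (\<lambda>t. 0)"
    by (simp add: P_def affine_fun_const rational_sums_0)
  then have const: "P (\<lambda>t. x)" for x
    by (induction x) (use P_point in auto)
  have mult: "P (\<lambda>t. L' t + x * t i)" if "P L'" "i < k" for L' i x
  proof (induction x)
    case (Suc x)
    from P_block[OF this \<open>i < k\<close>] show ?case by (simp add: algebra_simps)
  qed (use that in simp)
  have "P (\<lambda>t. b + wdeg j a t)" if "j \<le> k" for j
    using that
  proof (induction j)
    case 0
    show ?case using const by (simp add: wdeg_def)
  next
    case (Suc j)
    with mult[of "\<lambda>t. b + wdeg j a t" j "a j"] show ?case by (simp add: wdeg_Suc add.assoc)
  qed
  then have "P L" by (simp add: L[abs_def])
  then show ?thesis by (simp add: P_def)
qed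


section \<open>Rationality for trees of level \<open>d\<close>\<close>

lemma mod_rel_class: "\<mu> \<in> mod_rel \<rho> `` {\<nu>} \<longleftrightarrow> [\<nu> = \<mu>] (mod \<rho>)"
  by (simp add: mod_rel_def)

lemma mod_rel_class_eq: "[\<mu> = \<nu>] (mod \<rho>) \<Longrightarrow> mod_rel \<rho> `` {\<mu>} = mod_rel \<rho> `` {\<nu>}"
  by (auto simp: mod_rel_def cong_def)

context level0
begin

text \<open>Finite lengths are affine by \<open>linear_on_affine\<close>, nonnegative and constant
  modulo \<open>r\<close>, so \<open>affine_fun_nonneg\<close> applies. An infinite bone has the
  junk length \<open>0\<close>.\<close>

lemma bone_length_affine:
  assumes \<phi>: "affine_map k m \<phi>" "\<And>t. \<phi> t \<in> M" and e: "e \<in> edges S" and "0 < r"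
    and mod: "\<forall>\<kappa>\<in>M. \<forall>\<kappa>'\<in>M. \<forall>z z'. l e \<kappa> = Fin z \<longrightarrow> l e \<kappa>' = Fin z' \<longrightarrow>
      z mod int r = z' mod int r"
  shows "\<exists>b a. \<forall>t. bone_length l (\<phi> t) e = b + r * wdeg k a t"
  using e
proof (cases rule: edge_cases)
  case infinite
  then have "bone_length l (\<phi> t) e = 0 + r * wdeg k (\<lambda>_. 0) t" for t
    using \<phi>(2) by (simp add: bone_length_def wdeg_def)
  then show ?thesis by metis
next
  case finite
  have "linear_on m M (l e)"
    using datum e by (simp add: level0_datum_def)
  then have "affine_fun k (\<lambda>t. int (bone_length l (\<phi> t) e))"
    by (rule linear_on_affine[OF _ \<phi>]) (rule finite(1)[OF \<phi>(2)])
  then have "\<exists>b a. \<forall>t. int (bone_length l (\<phi> t) e) = int (b + r * wdeg k a t)"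
    by (rule affine_fun_nonneg) (use mod finite(1) \<phi>(2) \<open>0 < r\<close> in auto)
  then show ?thesis unfolding of_nat_eq_iff .
qed

text \<open>Induction along the path from the root, adding bone lengths. The variable part is
  divisible by \<open>r\<close>, so the residue class of \<open>joint_pos\<close> does not depend on
  \<open>t\<close>.\<close>

lemma joint_pos_affine:
  assumes \<phi>: "affine_map k m \<phi>" "\<And>t. \<phi> t \<in> M" and w: "w \<in> nodes S" and "0 < r"
    and mod: "\<forall>e\<in>edges S. \<forall>\<kappa>\<in>M. \<forall>\<kappa>'\<in>M. \<forall>z z'.
      l e \<kappa> = Fin z \<longrightarrow> l e \<kappa>' = Fin z' \<longrightarrow> z mod int r = z' mod int r"
  shows "\<exists>b a. \<forall>t. joint_pos S l (\<phi> t) w = b + r * wdeg k a t"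
  using w
proof (induction "depth S w" arbitrary: w)
  case 0
  then have "joint_pos S l (\<phi> t) w = 0 + r * wdeg k (\<lambda>_. 0) t" for t
    by (simp add: joint_pos_def wdeg_def 0(1)[symmetric])
  then show ?case by metis
next
  case (Suc n)
  have "nodes S \<noteq> {}" using Suc.prems by auto
  note S = rooted_tree_graded[OF rooted this]
  have "w \<noteq> root_of S" using gradedD(2)[OF S] Suc(2) by auto
  then obtain u where u: "(u, w) \<in> edges S"
    using gradedD(6)[OF S Suc.prems] by blast
  then have "n = depth S u" "u \<in> nodes S"
    using rooted_tree_edge[OF rooted u] Suc(2) by auto
  with Suc(1) obtain b a where "\<And>t. joint_pos S l (\<phi> t) u = b + r * wdeg k a t"
    by blast
  moreover obtain b' a' where "\<And>t. bone_length l (\<phi> t) (u, w) = b' + r * wdeg k a' t"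
    using bone_length_affine[OF \<phi> u \<open>0 < r\<close> bspec[OF mod u]] by blast
  ultimately have "joint_pos S l (\<phi> t) w = (b + b') + r * wdeg k (\<lambda>i. a i + a' i) t" for t
    by (simp add: joint_pos_edge[OF rooted u] wdeg_add distrib_left)
  then show ?case by metis
qed

lemma joint_depth_real:
  assumes "\<kappa> \<in> M" "w \<in> real_joints M S l"
  shows "joint_depth M S l w \<kappa> = Fin (int (joint_pos S l \<kappa> w))"
proof -
  have "Inl w \<in> nodes (skeleton M S l \<kappa>)" "nodes S \<noteq> {}"
    using assms(2) by (auto simp: nodes_skeleton real_joints_def)
  with assms graded_depth[OF skeleton_graded[OF assms(1)]] show ?thesis
    by (simp add: joint_depth_def real_joints_def)
qed

text \<open>A bone side branch is controlled only on \<open>bone_params\<close>; inserted nodes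
  supply such parameters. The upper bound comes from the lower joint and is infinite on an infinite
  bone.\<close>

lemma bone_params_mem:
  assumes \<kappa>: "\<kappa> \<in> M" and e: "e \<in> edges S" and "0 < i" "Fin (int i) < l e \<kappa>"
    and "\<mu> = int (joint_pos S l \<kappa> (fst e) + i)" "\<mu> \<in> \<Xi>"
  shows "\<kappa> @ [\<mu>] \<in> bone_params M S l e \<Xi>"
proof -
  obtain u w where uw: "e = (u, w)" by force
  have "joint_depth M S l u \<kappa> < Fin \<mu>"
    using joint_depth_real[OF \<kappa> upper_joint_real[of u w]] e uw assms by simp
  moreover have "Fin \<mu> < joint_depth M S l w \<kappa>"
    using e
  proof (cases rule: edge_cases)
    case infinite
    with virtual_iff[of u w \<kappa>] e \<kappa> show ?thesis by (simp add: uw joint_depth_def)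
  next
    case finite
    with virtual_iff[of u w \<kappa>] e \<kappa> have "w \<in> real_joints M S l"
      using rooted_tree_edge[OF rooted, of u w] by (auto simp: uw real_joints_def)
    with joint_depth_real[OF \<kappa> this] joint_pos_edge[OF rooted, of u w l \<kappa>] finite(1)[OF \<kappa>] assms
    show ?thesis by (simp add: uw)
  qed
  ultimately show ?thesis
    using assms uw unfolding bone_params_def by auto
qed

lemma rational_sums_bone_class:
  assumes \<phi>: "affine_map k m \<phi>" "\<And>t. \<phi> t \<in> M" and e: "e \<in> edges S" and "0 < r" "j < r"
    and mod: "\<forall>\<kappa>\<in>M. \<forall>\<kappa>'\<in>M. \<forall>z z'. l e \<kappa> = Fin z \<longrightarrow> l e \<kappa>' = Fin z' \<longrightarrow>
      z mod int r = z' mod int r"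
    and D: "\<And>t. D t = b + r * wdeg k a t"
    and h: "rational_counts (Suc m) P h"
    and P: "\<And>t s. Fin (int (Suc j + r * s)) < l e (\<phi> t) \<Longrightarrow> \<phi> t @ [int (D t + Suc j + r * s)] \<in> P"
  shows "rational_sums k (\<lambda>t n. \<Sum>s | Fin (int (Suc j + r * s)) < l e (\<phi> t) \<and> D t + Suc j + r * s \<le> n.
    h (\<phi> t @ [int (D t + Suc j + r * s)]) (n - (D t + Suc j + r * s)))"
proof -
  have aff_D: "affine_fun k (\<lambda>t. int (D t))"
  proof -
    have "int (D t) = int b + int r * int (0 + wdeg k a t)" for t
      by (simp add: D)
    then show ?thesis
      by (simp only:) (intro affine_fun_add affine_fun_const affine_fun_cmult affine_fun_wdeg)
  qed
  have affine: "affine_fun k' (\<lambda>t. int (D (\<psi> t) + Suc j + r * s t))"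
    if "\<And>i. i < k \<Longrightarrow> affine_fun k' (\<lambda>t. int (\<psi> t i))" "affine_fun k' (\<lambda>t. int (s t))" for k' \<psi> s
  proof -
    have "affine_fun k' (\<lambda>t. (int (D (\<psi> t)) + int (Suc j)) + int r * int (s t))"
      by (intro affine_fun_add affine_fun_const affine_fun_cmult affine_fun_subst[OF aff_D] that)
    then show ?thesis by (simp only: of_nat_add of_nat_mult)
  qed
  from e show ?thesis
  proof (cases rule: edge_cases)
    case infinite
    have \<phi>_k: "\<phi> (t(k := s)) = \<phi> t" and D_k: "D (t(k := s)) = D t" for t s
      by (rule affine_map_cong[OF \<phi>(1)]) (auto simp: D wdeg_upd_same)
    have "rational_sums (Suc k) (\<lambda>t. h (\<phi> t @ [int (D t + Suc j + r * t k)]))"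
    proof (rule rational_countsD[OF h])
      show "affine_map (Suc k) (Suc m) (\<lambda>t. \<phi> t @ [int (D t + Suc j + r * t k)])"
        by (intro affine_map_snoc affine_map_subst[OF \<phi>(1)] affine affine_fun_var) auto
      show "\<phi> t @ [int (D t + Suc j + r * t k)] \<in> P" for t
        by (rule P) (use infinite \<phi>(2) in simp)
    qed
    from rational_sums_unbounded[OF this \<open>0 < r\<close>, of "\<lambda>t. D t + Suc j" "b + Suc j" "\<lambda>i. r * a i"]
    show ?thesis
      using infinite \<phi>(2) by (simp add: D_k \<phi>_k) (simp add: D wdeg_def sum_distrib_left mult.assoc)
  next
    case finite
    obtain q a' where len: "\<And>t. bone_length l (\<phi> t) e = q + r * wdeg k a' t"
      using bone_length_affine[OF \<phi> e \<open>0 < r\<close> mod] by metis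
    have "0 < q"
      using len[of "\<lambda>_. 0"] finite(2)[OF \<phi>(2)] by (simp add: wdeg_def) (metis gr0I)
    \<comment> \<open>The number of \<open>s\<close> with
      \<open>Suc j + r * s < q + r * wdeg k a' t\<close>. Divisibility by \<open>r\<close> lets the
      variable part leave the rounded quotient, and \<open>0 < q\<close>, \<open>j < r\<close> keep
      the subtraction from truncating.\<close>
    define L where "L t = (q + r - 2 - j) div r + wdeg k a' t" for t
    have L: "Fin (int (Suc j + r * s)) < l e (\<phi> t) \<longleftrightarrow> s < L t" for s t
    proof -
      have "s < L t \<longleftrightarrow> Suc s \<le> ((q + r - 2 - j) + wdeg k a' t * r) div r"
        using \<open>0 < r\<close> by (simp add: L_def Suc_le_eq add.commute)
      also have "\<dots> \<longleftrightarrow> Suc s * r \<le> (q + r - 2 - j) + wdeg k a' t * r"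
        using \<open>0 < r\<close> by (rule less_eq_div_iff_mult_less_eq)
      also have "\<dots> \<longleftrightarrow> Suc j + r * s < q + r * wdeg k a' t"
        using \<open>0 < q\<close> \<open>j < r\<close> by (simp add: mult.commute) linarith
      finally show ?thesis
        using finite(1)[OF \<phi>(2)[of t]] by (simp add: len del: of_nat_add of_nat_mult of_nat_Suc)
    qed
    define F where "F t s n = (if D t + Suc j + r * s \<le> n
      then h (\<phi> t @ [int (D t + Suc j + r * s)]) (n - (D t + Suc j + r * s)) else 0)" for t s n
    have "rational_sums k (\<lambda>t n. \<Sum>s<L t. F t s n)"
    proof (rule rational_sums_bounded[OF _ L_def])
      fix k' \<psi> s
      assume \<psi>: "\<And>i. i < k \<Longrightarrow> affine_fun k' (\<lambda>t. int (\<psi> t i))"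
        and s: "affine_fun k' (\<lambda>t. int (s t))" and less: "\<And>t. s t < L (\<psi> t)"
      note aff = affine[of k' \<psi> s, OF \<psi> s]
      obtain b' a'' where D': "\<And>t. D (\<psi> t) + Suc j + r * s t = b' + wdeg k' a'' t"
        using affine_fun_nat[OF aff] by blast
      have "rational_sums k' (\<lambda>t. h (\<phi> (\<psi> t) @ [int (D (\<psi> t) + Suc j + r * s t)]))"
      proof (rule rational_countsD[OF h])
        show "affine_map k' (Suc m) (\<lambda>t. \<phi> (\<psi> t) @ [int (D (\<psi> t) + Suc j + r * s t)])"
          by (rule affine_map_snoc[OF affine_map_subst[OF \<phi>(1) \<psi>] aff])
        show "\<phi> (\<psi> t) @ [int (D (\<psi> t) + Suc j + r * s t)] \<in> P" for t
          by (rule P) (simp only: L less)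
      qed
      from rational_sums_shift[OF this D'] show "rational_sums k' (\<lambda>t. F (\<psi> t) (s t))"
        by (simp add: F_def[abs_def])
    qed
    also have "?this \<longleftrightarrow> ?thesis"
      unfolding L F_def
      by (rule rational_sums_cong, subst sum.inter_filter[symmetric]) (auto intro: sum.cong)
    finally show ?thesis .
  qed
qed

text \<open>Nodes of the bone are sorted by \<open>j = (i - 1) mod r\<close>. As the upper joint has
  constant depth modulo \<open>r\<close>, the class selecting the side branch depends on
  \<open>j\<close> alone, so each \<open>j\<close> leads to one fixed family of counts.\<close>

lemma rational_sums_bone:
  assumes \<phi>: "affine_map k m \<phi>" "\<And>t. \<phi> t \<in> M" and e: "e \<in> edges S" and "0 < r"
    and mod: "\<forall>e\<in>edges S. \<forall>\<kappa>\<in>M. \<forall>\<kappa>'\<in>M. \<forall>z z'.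
      l e \<kappa> = Fin z \<longrightarrow> l e \<kappa>' = Fin z' \<longrightarrow> z mod int r = z' mod int r"
    and h: "\<And>\<Xi>. \<Xi> \<in> UNIV // mod_rel (int r) \<Longrightarrow> rational_counts (Suc m) (bone_params M S l e \<Xi>) (h \<Xi>)"
  defines "D \<equiv> \<lambda>t. joint_pos S l (\<phi> t) (fst e)"
  shows "rational_sums k (\<lambda>t n. \<Sum>i | 0 < i \<and> Fin (int i) < l e (\<phi> t) \<and> D t + i \<le> n.
    h (mod_rel (int r) `` {int (D t + i)}) (\<phi> t @ [int (D t + i)]) (n - (D t + i)))"
proof -
  have "fst e \<in> nodes S"
    using rooted e by (cases e) (auto simp: rooted_tree_def)
  then obtain b a where D: "\<And>t. D t = b + r * wdeg k a t"
    using joint_pos_affine[OF \<phi> _ \<open>0 < r\<close> mod] unfolding D_def by metis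
  define \<Xi> where "\<Xi> j = mod_rel (int r) `` {int (b + Suc j)}" for j
  have \<Xi>_cong: "[int (D t + Suc j + r * s) = int (b + Suc j)] (mod int r)" for t j s
  proof -
    have "int (D t + Suc j + r * s) = int (b + Suc j) + int r * int (wdeg k a t + s)"
      by (simp add: D algebra_simps)
    then show ?thesis by (simp only: cong_def mod_mult_self2)
  qed
  have \<Xi>: "mod_rel (int r) `` {int (D t + Suc j + r * s)} = \<Xi> j" for t j s
    unfolding \<Xi>_def by (rule mod_rel_class_eq[OF \<Xi>_cong])
  let ?f = "\<lambda>t n i. h (mod_rel (int r) `` {int (D t + i)}) (\<phi> t @ [int (D t + i)]) (n - (D t + i))"
  let ?I = "\<lambda>t n j. {s. Fin (int (Suc j + r * s)) < l e (\<phi> t) \<and> D t + Suc j + r * s \<le> n}"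
  have "rational_sums k (\<lambda>t n. \<Sum>j<r. \<Sum>s\<in>?I t n j.
      h (\<Xi> j) (\<phi> t @ [int (D t + Suc j + r * s)]) (n - (D t + Suc j + r * s)))"
  proof (rule rational_sums_sum)
    fix j assume j: "j \<in> {..<r}"
    show "rational_sums k (\<lambda>t n. \<Sum>s\<in>?I t n j.
        h (\<Xi> j) (\<phi> t @ [int (D t + Suc j + r * s)]) (n - (D t + Suc j + r * s)))"
    proof (rule rational_sums_bone_class[OF \<phi> e \<open>0 < r\<close> _ bspec[OF mod e] D])
      show "rational_counts (Suc m) (bone_params M S l e (\<Xi> j)) (h (\<Xi> j))"
        by (rule h) (simp add: \<Xi>_def quotientI)
      fix t s assume "Fin (int (Suc j + r * s)) < l e (\<phi> t)"
      then show "\<phi> t @ [int (D t + Suc j + r * s)] \<in> bone_params M S l e (\<Xi> j)"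
      proof (rule bone_params_mem[OF \<phi>(2) e, rotated])
        show "int (D t + Suc j + r * s) \<in> \<Xi> j"
          unfolding \<Xi>_def mod_rel_class by (rule cong_sym[OF \<Xi>_cong])
      qed (simp_all add: D_def)
    qed (use j in simp)
  qed simp
  also have "?this \<longleftrightarrow> rational_sums k (\<lambda>t n. \<Sum>i | 0 < i \<and> Fin (int i) < l e (\<phi> t) \<and> D t + i \<le> n. ?f t n i)"
  proof (rule rational_sums_cong)
    fix t n
    have fin: "finite (?I t n j)" for j
    proof (rule finite_subset[of _ "{..n}"])
      show "?I t n j \<subseteq> {..n}"
      proof
        fix s assume "s \<in> ?I t n j"
        then have "r * s \<le> n" by simp
        moreover have "s \<le> r * s" using \<open>0 < r\<close> by simp
        ultimately show "s \<in> {..n}" unfolding atMost_iff by (rule order_trans[rotated])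
      qed
    qed simp
    have "(\<Sum>j<r. \<Sum>s\<in>?I t n j. h (\<Xi> j) (\<phi> t @ [int (D t + Suc j + r * s)]) (n - (D t + Suc j + r * s))) =
        (\<Sum>j<r. \<Sum>s\<in>?I t n j. ?f t n (Suc j + r * s))"
      using \<Xi> by (simp only: add.assoc)
    also have "\<dots> = (\<Sum>(j, s)\<in>(SIGMA j:{..<r}. ?I t n j). ?f t n (Suc j + r * s))"
      using fin by (subst sum.Sigma) auto
    also have "\<dots> = (\<Sum>i | 0 < i \<and> Fin (int i) < l e (\<phi> t) \<and> D t + i \<le> n. ?f t n i)"
    \<comment> \<open>Inserted nodes are numbered from \<open>1\<close>, so division with remainder
      is applied to \<open>i - 1\<close>.\<close>
    proof (rule sum.reindex_bij_witness[of _ "\<lambda>i. ((i - 1) mod r, (i - 1) div r)" "\<lambda>(j, s). Suc j + r * s"], goal_cases)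
      case (5 x)
      show ?case by (cases x) (simp only: prod.case add.assoc)
    next
      case (1 x)
      then show ?case using \<open>0 < r\<close> by auto
    next
      case (2 x)
      then show ?case by (auto simp: add.assoc)
    next
      case (3 i)
      then show ?case by auto
    next
      case (4 i)
      then have "Suc ((i - 1) mod r) + r * ((i - 1) div r) = i"
        by simp
      with 4 \<open>0 < r\<close> show ?case
        by (simp add: add.assoc del: of_nat_add of_nat_mult of_nat_Suc)
    qed
    finally show "(\<Sum>j<r. \<Sum>s\<in>?I t n j. h (\<Xi> j) (\<phi> t @ [int (D t + Suc j + r * s)]) (n - (D t + Suc j + r * s))) =
      (\<Sum>i | 0 < i \<and> Fin (int i) < l e (\<phi> t) \<and> D t + i \<le> n. ?f t n i)" .
  qed
  finally show ?thesis .
qed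

text \<open>Assembles finitely many contributions: a shift by an affine depth for each real joint
  and one bone sum for each bone.\<close>

lemma rational_counts_skel_sum:
  assumes "0 < r"
    and mod: "\<forall>e\<in>edges S. \<forall>\<kappa>\<in>M. \<forall>\<kappa>'\<in>M. \<forall>z z'.
      l e \<kappa> = Fin z \<longrightarrow> l e \<kappa>' = Fin z' \<longrightarrow> z mod int r = z' mod int r"
    and hj: "\<And>w. w \<in> real_joints M S l \<Longrightarrow> rational_counts m M (hj w)"
    and hb: "\<And>e \<Xi>. e \<in> edges S \<Longrightarrow> \<Xi> \<in> UNIV // mod_rel (int r) \<Longrightarrow>
      rational_counts (Suc m) (bone_params M S l e \<Xi>) (hb e \<Xi>)"
  shows "rational_counts m M (skel_sum hj (\<lambda>e \<mu>. hb e (mod_rel (int r) `` {\<mu>})))"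
  unfolding rational_counts_def
proof (intro allI impI)
  fix k \<phi> assume \<phi>: "affine_map k m \<phi>" "\<forall>t. \<phi> t \<in> M"
  then have \<phi>': "\<And>t. \<phi> t \<in> M" by blast
  have fin: "finite (real_joints M S l)"
    using finite_nodes by (simp add: real_joints_def)
  have joint: "rational_sums k (\<lambda>t n. if joint_pos S l (\<phi> t) w \<le> n
      then hj w (\<phi> t) (n - joint_pos S l (\<phi> t) w) else 0)" if w: "w \<in> real_joints M S l" for w
  proof -
    \<comment> \<open>Only affineness is wanted here, so modulus \<open>1\<close> is taken, for
      which the congruences are trivial.\<close>
    obtain b a where "\<And>t. joint_pos S l (\<phi> t) w = b + 1 * wdeg k a t"
      using joint_pos_affine[OF \<phi>(1) \<phi>', of w 1] w by (auto simp: real_joints_def)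
    then show ?thesis
      by (intro rational_sums_shift[OF rational_countsD[OF hj[OF w] \<phi>(1) \<phi>']]) simp
  qed
  show "rational_sums k (\<lambda>t. skel_sum hj (\<lambda>e \<mu>. hb e (mod_rel (int r) `` {\<mu>})) (\<phi> t))"
    unfolding skel_sum_def
    by (intro rational_sums_add rational_sums_sum rational_sums_bone fin finite_edges joint
        \<phi>(1) \<phi>' \<open>0 < r\<close> mod hb)
qed

end

text \<open>\<open>F\<close> does not depend on \<open>\<kappa>\<close>, so all shifts are constant:
  inner nodes contribute shifted delta functions, and leaves contribute shifted counts with powers
  of \<open>p\<close> from the product with \<open>Tzp p\<close>.\<close>

lemma rational_counts_side_branch:
  assumes F: "rooted_tree F" "finite (nodes F)" "nodes F \<noteq> {}"
    and T: "\<And>w \<kappa>. w \<in> leaves F \<Longrightarrow> \<kappa> \<in> M \<Longrightarrow> rooted_tree (T w \<kappa>)"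
      "\<And>w \<kappa>. w \<in> leaves F \<Longrightarrow> \<kappa> \<in> M \<Longrightarrow> nodes (T w \<kappa>) \<noteq> {}"
      "\<And>w \<kappa>. w \<in> leaves F \<Longrightarrow> \<kappa> \<in> M \<Longrightarrow> locally_finite (T w \<kappa>)"
    and h: "\<And>w. w \<in> leaves F \<Longrightarrow> rational_counts m M (\<lambda>\<kappa> n. of_nat (card (level (T w \<kappa>) n)))"
  shows "rational_counts m M (\<lambda>\<kappa> n. of_nat (card (level (side_branch p (F, T) \<kappa>) n)))"
proof -
  have fin: "finite (nodes F - leaves F)" "finite (leaves F)"
    using F(2) finite_subset[of "leaves F" "nodes F"] by (auto simp: leaves_def)
  let ?h = "\<lambda>\<kappa> n. (\<Sum>x\<in>nodes F - leaves F. if depth F x \<le> n then (if n - depth F x = 0 then 1 else 0) else 0) +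
      (\<Sum>w\<in>leaves F. if depth F w \<le> n
         then of_nat p ^ (n - depth F w) * of_nat (card (level (T w \<kappa>) (n - depth F w))) else 0) :: rat"
  have "rational_counts m M ?h"
    by (intro rational_counts_add rational_counts_sum fin rational_counts_shift[of _ _ "\<lambda>_ n. if n = 0 then 1 else 0"]
        rational_counts_shift[of _ _ "\<lambda>\<kappa> n. of_nat p ^ n * of_nat (card (level (T _ \<kappa>) n))"]
        rational_counts_delta rational_counts_power h)
  also have "?this \<longleftrightarrow> ?thesis"
  proof (rule rational_counts_cong)
    fix \<kappa> n assume "\<kappa> \<in> M"
    have "(of_nat (card {x \<in> nodes F - leaves F. depth F x = n}) :: rat) =
        (\<Sum>x\<in>{x \<in> nodes F - leaves F. depth F x = n}. 1)"
      by simp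
    also have "\<dots> = (\<Sum>x\<in>nodes F - leaves F. if depth F x \<le> n then (if n - depth F x = 0 then 1 else 0) else 0)"
      using fin(1) by (intro sum.mono_neutral_cong_left) auto
    finally show "?h \<kappa> n = of_nat (card (level (side_branch p (F, T) \<kappa>) n))"
      by (subst side_branch_level(2)[OF F T]) (use \<open>\<kappa> \<in> M\<close> in \<open>auto intro!: sum.cong\<close>)
  qed
  finally show ?thesis .
qed

section \<open>Induction on the level and conclusion\<close>

lemma nat_level_tree_rooted:
  "nat_level_tree p d m M T \<Longrightarrow> \<kappa> \<in> M \<Longrightarrow> rooted_tree (T \<kappa>)"
  by (cases d) (auto simp: parametrized_tree_def)

text \<open>Induction on \<open>d\<close> for all \<open>m\<close> and \<open>M\<close> at once,
  since bone side branches have one more parameter. Local finiteness is carried along because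
  \<open>level_attach\<close> uses it to add cardinalities.\<close>

lemma nat_level_tree_rational_counts:
  assumes "nat_level_tree p d m M T"
  shows "rational_counts m M (\<lambda>\<kappa> n. of_nat (card (level (T \<kappa>) n))) \<and> (\<forall>\<kappa>\<in>M. locally_finite (T \<kappa>))"
  using assms
proof (induction d arbitrary: m M T)
  case 0
  then obtain S l where datum: "level0_datum m M S l" and iso: "\<And>\<kappa>. \<kappa> \<in> M \<Longrightarrow> tree_iso (T \<kappa>) (skeleton M S l \<kappa>)"
    by auto
  interpret level0 m M S l using datum by unfold_locales
  have T: "card (level (T \<kappa>) n) = card (level (skeleton M S l \<kappa>) n)"
    "finite (level (T \<kappa>) n) = finite (level (skeleton M S l \<kappa>) n)" if "\<kappa> \<in> M" for \<kappa> n
    by (rule card_level_iso[OF nat_level_tree_rooted[OF 0 that] iso[OF that]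
          skeleton_graded[OF that nodes_S_if_skeleton]]; assumption)+
  \<comment> \<open>Level 0 is the case of one-point attachments with \<open>r = 1\<close>.\<close>
  have "rational_counts m M (skel_sum (\<lambda>_ _ n. if n = 0 then 1 else 0) (\<lambda>_ _ _ n. if n = 0 then 1 else 0))"
    using rational_counts_skel_sum[of 1 "\<lambda>_ _ n. if n = 0 then 1 else 0" "\<lambda>_ _ _ n. if n = 0 then 1 else 0"]
    by (simp add: rational_counts_delta)
  also have "?this \<longleftrightarrow> rational_counts m M (\<lambda>\<kappa> n. of_nat (card (level (T \<kappa>) n)))"
    by (rule rational_counts_cong) (simp add: T card_level_skeleton)
  finally show ?case
    using T(2) skeleton_locally_finite by (simp add: locally_finite_def)
next
  case (Suc d)
  obtain \<rho> S l Bj Bb where "0 < \<rho>" and datum: "level0_datum m M S l"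
    and mod: "\<forall>e\<in>edges S. \<forall>\<kappa>\<in>M. \<forall>\<kappa>'\<in>M. \<forall>z z'.
      l e \<kappa> = Fin z \<longrightarrow> l e \<kappa>' = Fin z' \<longrightarrow> z mod \<rho> = z' mod \<rho>"
    and joints: "\<forall>w\<in>real_joints M S l. side_branch_datum (nat_level_tree p d m M) M (Bj w)"
    and bones: "\<forall>e\<in>edges S. \<forall>\<Xi>\<in>UNIV // mod_rel \<rho>.
      side_branch_datum (nat_level_tree p d (Suc m) (bone_params M S l e \<Xi>)) (bone_params M S l e \<Xi>) (Bb e \<Xi>)"
    and isos: "\<forall>\<kappa>\<in>M. tree_iso (T \<kappa>) (datum_tree p \<rho> M S l Bj Bb \<kappa>)"
    using Suc.prems unfolding nat_level_tree.simps by (elim conjE exE)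
  note Bj = joints[rule_format] and Bb = bones[rule_format] and iso = isos[rule_format]
  interpret level0 m M S l using datum by unfold_locales
  obtain r where r: "\<rho> = int r" "0 < r"
    using \<open>0 < \<rho>\<close> by (metis pos_int_cases)
  have side: "rational_counts m' M' (\<lambda>\<kappa> n. of_nat (card (level (side_branch p B \<kappa>) n))) \<and>
      (\<forall>\<kappa>\<in>M'. graded_finite (side_branch p B \<kappa>))"
    if "side_branch_datum (nat_level_tree p d m' M') M' B" for m' M' B
  proof -
    obtain F U where B: "B = (F, U)" by force
    then have F: "rooted_tree F" "finite (nodes F)" "nodes F \<noteq> {}"
      and U: "\<And>w. w \<in> leaves F \<Longrightarrow> nat_level_tree p d m' M' (U w)"
        "\<And>w \<kappa>. w \<in> leaves F \<Longrightarrow> \<kappa> \<in> M' \<Longrightarrow> nodes (U w \<kappa>) \<noteq> {}"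
      using that by (auto simp: side_branch_datum_def)
    note U' = nat_level_tree_rooted[OF U(1)] U(2)
    note IH = Suc.IH[OF U(1)]
    have fin: "locally_finite (U w \<kappa>)" if "w \<in> leaves F" "\<kappa> \<in> M'" for w \<kappa>
      using IH[OF that(1)] that(2) by blast
    have "rational_counts m' M' (\<lambda>\<kappa> n. of_nat (card (level (side_branch p B \<kappa>) n)))"
      unfolding B by (rule rational_counts_side_branch[OF F U' fin]) (use IH in auto)
    moreover have "graded_finite (side_branch p B \<kappa>)"
      if "\<kappa> \<in> M'" for \<kappa>
      unfolding B using side_branch_level(1)[of F U \<kappa>] F U' fin that by blast
    ultimately show ?thesis by blast
  qed
  let ?hj = "\<lambda>w \<kappa> n. rat_of_nat (card (level (side_branch p (Bj w) \<kappa>) n))"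
  let ?hb = "\<lambda>e \<Xi> \<kappa> n. rat_of_nat (card (level (side_branch p (Bb e \<Xi>) \<kappa>) n))"
  have bone: "graded_finite (side_branch p (Bb e (mod_rel \<rho> `` {\<mu>})) (\<kappa> @ [\<mu>]))"
    if "\<kappa> \<in> M" "e \<in> edges S" "0 < i" "Fin (int i) < l e \<kappa>" "\<mu> = int (joint_pos S l \<kappa> (fst e) + i)" for e i \<mu> \<kappa>
  proof -
    have "mod_rel \<rho> `` {\<mu>} \<in> UNIV // mod_rel \<rho>"
      by (simp add: quotientI)
    from side[OF Bb[OF that(2) this]] bone_params_mem[OF that, of "mod_rel \<rho> `` {\<mu>}"] show ?thesis
      by (simp add: mod_rel_def)
  qed
  have tree: "(nodes (datum_tree p \<rho> M S l Bj Bb \<kappa>) \<noteq> {} \<longrightarrow> (\<exists>r \<delta>. graded (datum_tree p \<rho> M S l Bj Bb \<kappa>) r \<delta>)) \<and>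
      finite (level (datum_tree p \<rho> M S l Bj Bb \<kappa>) n) \<and>
      of_nat (card (level (datum_tree p \<rho> M S l Bj Bb \<kappa>) n)) =
        skel_sum ?hj (\<lambda>e \<mu>. ?hb e (mod_rel \<rho> `` {\<mu>})) \<kappa> n" if \<kappa>: "\<kappa> \<in> M" for \<kappa> n
  \<comment> \<open>An empty skeleton has no root to grade from; then there are no real joints and
    no bones, and both counts are zero.\<close>
  proof (cases "nodes (skeleton M S l \<kappa>) = {}")
    case True
    then have empty: "nodes (datum_tree p \<rho> M S l Bj Bb \<kappa>) = {}"
      by (auto simp: datum_tree_def attach_def Let_def)
    have "real_joints M S l = {}" "edges S = {}"
      using True upper_joint_real by (auto simp: nodes_skeleton)
    with empty show ?thesis by (simp add: skel_sum_def level_def)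
  next
    case False
    have joints: "\<forall>w\<in>real_joints M S l. graded_finite (side_branch p (Bj w) \<kappa>)"
      using side[OF Bj] \<kappa> by blast
    have bones: "\<forall>e\<in>edges S. \<forall>i>0. Fin (int i) < l e \<kappa> \<longrightarrow>
      (let \<mu> = int (joint_pos S l \<kappa> (fst e) + i)
       in graded_finite (side_branch p (Bb e (mod_rel \<rho> `` {\<mu>})) (\<kappa> @ [\<mu>])))"
      unfolding Let_def using bone[OF \<kappa> _ _ _ refl] by blast
    show ?thesis
      using datum_tree_level[OF \<kappa> False joints bones] by blast
  qed
  have T: "card (level (T \<kappa>) n) = card (level (datum_tree p \<rho> M S l Bj Bb \<kappa>) n)"
    "finite (level (T \<kappa>) n) = finite (level (datum_tree p \<rho> M S l Bj Bb \<kappa>) n)" if \<kappa>: "\<kappa> \<in> M" for \<kappa> n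
  proof -
    obtain r \<delta> where "nodes (datum_tree p \<rho> M S l Bj Bb \<kappa>) \<noteq> {} \<Longrightarrow> graded (datum_tree p \<rho> M S l Bj Bb \<kappa>) r \<delta>"
      using tree[OF \<kappa>] by blast
    note * = card_level_iso[OF nat_level_tree_rooted[OF Suc.prems \<kappa>] iso[OF \<kappa>] this]
    show "card (level (T \<kappa>) n) = card (level (datum_tree p \<rho> M S l Bj Bb \<kappa>) n)"
      by (rule *(1))
    show "finite (level (T \<kappa>) n) = finite (level (datum_tree p \<rho> M S l Bj Bb \<kappa>) n)"
      by (rule *(2))
  qed
  have "rational_counts m M (skel_sum ?hj (\<lambda>e \<mu>. ?hb e (mod_rel \<rho> `` {\<mu>})))"
    unfolding r(1)
  proof (rule rational_counts_skel_sum[OF r(2) mod[unfolded r(1)]])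
    show "rational_counts m M (?hj w)" if "w \<in> real_joints M S l" for w
      using side[OF Bj[OF that]] by blast
    show "rational_counts (Suc m) (bone_params M S l e \<Xi>) (?hb e \<Xi>)"
      if "e \<in> edges S" "\<Xi> \<in> UNIV // mod_rel (int r)" for e \<Xi>
      using side[OF Bb[OF that[folded r(1)]]] by blast
  qed
  also have "?this \<longleftrightarrow> rational_counts m M (\<lambda>\<kappa> n. of_nat (card (level (T \<kappa>) n)))"
    by (rule rational_counts_cong) (simp add: T tree)
  finally show ?case
    using T(2) tree by (simp add: locally_finite_def)
qed

theorem proposition5p2:
  fixes p d :: nat and T :: "'a rtree"
  assumes "prime p"
    and "unparametrized_level_tree p d T"
  shows "rational_series (poincare_series T)"
proof -
  obtain T' where T: "rooted_tree T" and T': "nat_level_tree p d 0 {[]} T'" and iso: "tree_iso T (T' [])"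
    using assms(2) by (auto simp: unparametrized_level_tree_def level_tree_def parametrized_tree_def)
  have "rooted_tree (T' [])"
    using nat_level_tree_rooted[OF T'] by simp
  then have count: "card (level T n) = card (level (T' []) n)" for n
    using card_level_iso(1)[OF T iso rooted_tree_graded] by blast
  let ?g = "\<lambda>(t :: nat \<Rightarrow> nat) n. rat_of_nat (card (level (T' []) n))"
  have "rational_sums 0 ?g"
    by (rule rational_countsD[OF conjunct1[OF nat_level_tree_rational_counts[OF T']], of _ "\<lambda>_. []"])
      (auto simp: affine_map_def)
  \<comment> \<open>Without variables the positivity condition is empty, and with
    \<open>q = 1\<close> the weighted series is the Poincare series itself.\<close>
  then have "rational_fps (wseries 0 (\<lambda>_. 0) (\<lambda>_. 0) 1 ?g)"
    by (simp add: rational_sums_def)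
  moreover have "wseries 0 (\<lambda>_. 0) (\<lambda>_. 0) 1 ?g = Abs_fps (\<lambda>n. of_int (fps_nth (poincare_series T) n))"
  proof (rule fps_ext)
    fix N
    have "fiber 0 (\<lambda>_. 0) N = {(\<lambda>_. 0, N)}"
      by (auto simp: fiber_def tuples_0 wdeg_def)
    then show "wseries 0 (\<lambda>_. 0) (\<lambda>_. 0) 1 ?g $ N = Abs_fps (\<lambda>n. of_int (fps_nth (poincare_series T) n)) $ N"
      using count[of N] by (simp add: wseries_def wval_def poincare_series_def level_def)
  qed
  ultimately obtain f g where "g \<noteq> 0"
      "fps_of_poly g * Abs_fps (\<lambda>n. of_int (fps_nth (poincare_series T) n)) = fps_of_poly (f :: rat poly)"
    unfolding rational_fps_def by auto
  \<comment> \<open>Passes from the cleared denominator in the power series ring to a quotient in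
    the field of Laurent series.\<close>
  moreover from this have "fps_to_fls (fps_of_poly g) * fps_to_fls (Abs_fps (\<lambda>n. of_int (fps_nth (poincare_series T) n)))
      = fps_to_fls (fps_of_poly f)"
    by (metis fls_times_fps_to_fls)
  moreover have "fps_to_fls (fps_of_poly g) \<noteq> 0"
    using \<open>g \<noteq> 0\<close> by simp
  ultimately show ?thesis
    unfolding rational_series_def by (metis nonzero_mult_div_cancel_left)
qed

end
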